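(* Let $C$ be the non-complete intersection Gorenstein monomial curve $x_i=t^{n_i}$ ($1\le i\le4$) in $\mathbb{A}^4(K)$, with $n_1<n_2<n_3<n_4$. Suppose that $I(C)$ is given as in case 3(b), i.e. $I(C)$ is minimally generated by $$f_1=x_1^{a_1}-x_2^{a_{12}}x_4^{a_{14}},\quad f_2=x_2^{a_2}-x_3^{a_{23}}x_4^{a_{24}},\quad f_3=x_3^{a_3}-x_1^{a_{31}}x_2^{a_{32}},$$ $$f_4=x_4^{a_4}-x_1^{a_{41}}x_3^{a_{43}},\quad f_5=x_1^{a_{31}}x_4^{a_{24}}-x_2^{a_{12}}x_3^{a_{43}}.$$ Then $C$ has Cohen-Macaulay tangent cone at the origin if and only if (1) $a_{12}+a_{43}\le a_{31}+a_{24}$, and (2) for every monomial $M=x_2^{u_2}x_3^{u_3}x_4^{u_4}$, where $u_2\ge a_2$, $u_3<a_{43}$ and $u_4<a_{14}$, with $u_2n_2+u_3n_3+u_4n_4\in n_1+\mathcal{S}$, there exists a monomial $N$ with $1\in\mathrm{supp}(N)$ such that $M-N\in I(C)$ and $\deg(M)\le\deg(N)$.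
   Context: $K$ is a field and $n_1,\dots,n_4$ are positive integers with $\gcd(n_1,\dots,n_4)=1$. $\mathbb{N}$ denotes the non-negative integers (exponents $u_i$ are in $\mathbb{N}$), $\mathcal{S}=\{g_1n_1+\cdots+g_4n_4: g_i\in\mathbb{N}\}$ and $n_1+\mathcal{S}=\{n_1+m:m\in\mathcal{S}\}$. $I(C)$ is the kernel of the $K$-algebra homomorphism $K[x_1,\dots,x_4]\to K[t]$, $x_i\mapsto t^{n_i}$. $C$ is Gorenstein if $\mathcal{S}$ is symmetric. For a monomial, $\deg(x_1^{u_1}\cdots x_4^{u_4})=u_1+\cdots+u_4$, and $\mathrm{supp}$ is the set of indices $i$ such that $x_i$ divides it. In the description of $I(C)$, all exponents are integers with $0<a_{ij}<a_j$, and (by Bresinsky) $a_1=a_{31}+a_{41}$, $a_2=a_{12}+a_{32}$, $a_3=a_{23}+a_{43}$, $a_4=a_{14}+a_{24}$. $C$ has Cohen-Macaulay tangent cone at the origin if the ring $K[x_1,\dots,x_4]/I(C)_*$ is Cohen-Macaulay, where $I(C)_*$ is generated by the homogeneous (standard grading) summands $f_*$ of least degree of the polynomials $f\in I(C)$. *)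

theory Defs
  imports
    "HOL-Library.Poly_Mapping"
    "HOL-Library.Numeral_Type"
    "HOL-Library.Extended_Nat"
    "HOL-Algebra.Algebra"
    "HOL-Algebra.Algebraic_Closure_Type"
begin

section \<open>Depth, codimension and Cohen-Macaulay rings\<close>

definition regular_sequence :: "('a, 'b) ring_scheme \<Rightarrow> 'a list \<Rightarrow> bool" where
  "regular_sequence R xs \<longleftrightarrow>
     set xs \<subseteq> carrier R \<and> Idl\<^bsub>R\<^esub> (set xs) \<noteq> carrier R \<and>
     (\<forall>i<length xs. \<forall>r\<in>carrier R.
        xs ! i \<otimes>\<^bsub>R\<^esub> r \<in> Idl\<^bsub>R\<^esub> (set (take i xs)) \<longrightarrow> r \<in> Idl\<^bsub>R\<^esub> (set (take i xs)))"

text \<open>The depth of \<open>I\<close> on \<open>R\<close>, i.e. the supremum of the lengths of the \<open>R\<close>-sequences contained in \<open>I\<close>.\<close>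

definition ideal_depth :: "('a, 'b) ring_scheme \<Rightarrow> 'a set \<Rightarrow> enat" where
  "ideal_depth R I = Sup {enat (length xs) | xs. regular_sequence R xs \<and> set xs \<subseteq> I}"

text \<open>The codimension (height) of a prime \<open>P\<close>: the supremum of the lengths \<open>k\<close> of chains
  \<open>Q 0 \<subset> \<dots> \<subset> Q k = P\<close> of prime ideals.\<close>

definition codimension :: "('a, 'b) ring_scheme \<Rightarrow> 'a set \<Rightarrow> enat" where
  "codimension R P = Sup {enat k | k. \<exists>Q :: nat \<Rightarrow> 'a set.
     (\<forall>i\<le>k. primeideal (Q i) R) \<and> (\<forall>i<k. Q i \<subset> Q (Suc i)) \<and> Q k = P}"

text \<open>A Noetherian commutative ring is Cohen-Macaulay if depth and codimension agree at every
  maximal ideal (D. Eisenbud, Commutative Algebra with a View Toward Algebraic Geometry,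
  Section 18.2).\<close>

definition cohen_macaulay_ring :: "('a, 'b) ring_scheme \<Rightarrow> bool" where
  "cohen_macaulay_ring R \<longleftrightarrow>
     cring R \<and> noetherian_ring R \<and> (\<forall>P. maximalideal P R \<longrightarrow> ideal_depth R P = codimension R P)"


section \<open>The polynomial ring in four variables\<close>

text \<open>The index type \<^typ>\<open>4\<close> has the elements \<open>1\<close>, \<open>2\<close>, \<open>3\<close> and \<open>4\<close> (where \<open>4 = 0\<close>); its order
  and arithmetic are never used. Exponent vectors are functions from \<^typ>\<open>4\<close> to \<^typ>\<open>nat\<close>, and
  the multiplication of \<open>'k poly4\<close> is the convolution product.\<close>

type_synonym expo4 = "4 \<Rightarrow>\<^sub>0 nat"
type_synonym 'k poly4 = "expo4 \<Rightarrow>\<^sub>0 'k"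

definition xmonomial :: "expo4 \<Rightarrow> 'k::field poly4" where
  "xmonomial u = Poly_Mapping.single u 1"

definition xvar :: "4 \<Rightarrow> 'k::field poly4" where
  "xvar i = xmonomial (Poly_Mapping.single i 1)"

definition expo_deg :: "expo4 \<Rightarrow> nat" where
  "expo_deg u = (\<Sum>i\<in>UNIV. Poly_Mapping.lookup u i)"

abbreviation poly4_ring :: "'k::field poly4 ring" where
  "poly4_ring \<equiv> ring_of_type_algebra"

text \<open>The homogeneous summand of least degree; it is \<open>0\<close> for the zero polynomial, since then the
  sum is empty.\<close>

definition least_form :: "'k::field poly4 \<Rightarrow> 'k poly4" where
  "least_form f =
     (\<Sum>u\<in>{u \<in> Poly_Mapping.keys f. expo_deg u = Min (expo_deg ` Poly_Mapping.keys f)}.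
        Poly_Mapping.single u (Poly_Mapping.lookup f u))"

definition tangent_ideal :: "'k::field poly4 set \<Rightarrow> 'k poly4 set" where
  "tangent_ideal I = Idl\<^bsub>poly4_ring\<^esub> (least_form ` I)"

definition minimally_generates :: "'k::field poly4 set \<Rightarrow> 'k poly4 set \<Rightarrow> bool" where
  "minimally_generates G I \<longleftrightarrow>
     Idl\<^bsub>poly4_ring\<^esub> G = I \<and> (\<forall>H. H \<subset> G \<longrightarrow> Idl\<^bsub>poly4_ring\<^esub> H \<noteq> I)"


section \<open>Monomial curves in affine 4-space\<close>

text \<open>The \<open>K\<close>-algebra homomorphism from \<open>K[x\<^sub>1,\<dots>,x\<^sub>4]\<close> to \<open>K[t]\<close> with \<open>x\<^sub>i \<mapsto> t\<^bsup>n i\<^esup>\<close>.\<close>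

definition curve_hom :: "(4 \<Rightarrow> nat) \<Rightarrow> 'k::field poly4 \<Rightarrow> 'k Polynomial.poly" where
  "curve_hom n f =
     (\<Sum>u\<in>Poly_Mapping.keys f. Polynomial.smult (Poly_Mapping.lookup f u)
        (\<Prod>i\<in>UNIV. Polynomial.monom 1 (n i) ^ Poly_Mapping.lookup u i))"

definition curve_ideal :: "(4 \<Rightarrow> nat) \<Rightarrow> 'k::field poly4 set" where
  "curve_ideal n = {f. curve_hom n f = 0}"

definition curve_semigroup :: "(4 \<Rightarrow> nat) \<Rightarrow> nat set" where
  "curve_semigroup n = {\<Sum>i\<in>UNIV. g i * n i | g. True}"

text \<open>A numerical semigroup \<open>S\<close> with Frobenius number \<open>F\<close> is symmetric if, for every integer \<open>z\<close>,
  exactly one of \<open>z\<close> and \<open>F - z\<close> lies in \<open>S\<close>. The Frobenius number is the greatest integer not in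
  \<open>S\<close>; it exists when the generators have greatest common divisor \<open>1\<close>, and it is \<open>-1\<close> for
  \<open>S = UNIV\<close>.\<close>

definition frobenius_number :: "nat set \<Rightarrow> int" where
  "frobenius_number S = (GREATEST z. z \<notin> int ` S)"

definition symmetric_semigroup :: "nat set \<Rightarrow> bool" where
  "symmetric_semigroup S \<longleftrightarrow> (\<forall>z. z \<in> int ` S \<longleftrightarrow> frobenius_number S - z \<notin> int ` S)"

definition gorenstein_curve :: "(4 \<Rightarrow> nat) \<Rightarrow> bool" where
  "gorenstein_curve n \<longleftrightarrow> symmetric_semigroup (curve_semigroup n)"

text \<open>The curve has codimension \<open>3\<close>, so it is a complete intersection if its ideal is generated by
  three polynomials.\<close>

definition complete_intersection_curve :: "'k::field itself \<Rightarrow> (4 \<Rightarrow> nat) \<Rightarrow> bool" where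
  "complete_intersection_curve _ n \<longleftrightarrow>
     (\<exists>F :: 'k poly4 set. card F = 3 \<and> curve_ideal n = Idl\<^bsub>poly4_ring\<^esub> F)"

definition cohen_macaulay_tangent_cone :: "'k::field itself \<Rightarrow> (4 \<Rightarrow> nat) \<Rightarrow> bool" where
  "cohen_macaulay_tangent_cone _ n \<longleftrightarrow>
     cohen_macaulay_ring (poly4_ring Quot tangent_ideal (curve_ideal n :: 'k poly4 set))"

end

theory Submission
  imports Defs
begin

text \<open>Let \<open>I\<close> be the ideal of the curve, \<open>I\<^sub>*\<close> its tangent ideal and \<open>G = K[x\<^sub>1,\<dots>,x\<^sub>4]/I\<^sub>*\<close>. The proof
turns the Cohen-Macaulay property of \<open>G\<close> into a statement about degrees of monomials, which the five
binomials then decide.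

\<^emph>\<open>From the ring to the element \<open>x\<^sub>1\<close>.\<close> Since \<open>n\<^sub>1\<close> is the least of the \<open>n\<^sub>i\<close>, the binomial
\<open>x\<^sub>i^n\<^sub>1 - x\<^sub>1^n\<^sub>i\<close> of \<open>I\<close> has least form \<open>x\<^sub>i^n\<^sub>1\<close> for \<open>i \<noteq> 1\<close>, whereas no element of \<open>I\<^sub>*\<close> has a
power of \<open>x\<^sub>1\<close> among its terms. So \<open>G\<close> becomes \<open>K[x\<^sub>1]\<close> when its nilpotents are divided out
(\<open>thickened_line_top_kernel\<close>). In a ring of this kind every maximal ideal has codimension \<open>1\<close>
(\<open>codimension_maximal\<close>) and no regular sequence has two members (\<open>regular_sequence_length\<close>). Hence
\<open>G\<close> is Cohen-Macaulay if and only if every maximal ideal contains a nonzerodivisor. At the origin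
this says that \<open>x\<^sub>1\<close> is a nonzerodivisor, because an element of that maximal ideal has a power
divisible by \<open>x\<^sub>1\<close> in \<open>G\<close>. Conversely, if \<open>x\<^sub>1\<close> is a nonzerodivisor, then so is every nonzero
polynomial in \<open>x\<^sub>1\<close>, by comparing the parts of lowest weight, and every maximal ideal contains such a
polynomial (\<open>cohen_macaulay_iff\<close>, \<open>axis_poly_nonzerodivisor\<close>).

\<^emph>\<open>From \<open>x\<^sub>1\<close> to monomials.\<close> Give \<open>x\<^sub>i\<close> the weight \<open>n\<^sub>i\<close>, so that the fibres of \<open>x\<^sub>i \<mapsto> t^n\<^sub>i\<close> on
monomials are the monomials of equal weight, and call a monomial of top degree if its degree is
maximal in its fibre. A polynomial lies in \<open>I\<^sub>*\<close> if and only if, in each fibre, its coefficients at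
the monomials of top degree add up to zero (\<open>tangent_ideal_curve_ideal\<close>). Therefore \<open>x\<^sub>1\<close> is a
nonzerodivisor on \<open>G\<close> if and only if multiplication by \<open>x\<^sub>1\<close> preserves top degree
(\<open>xvar_nonzerodivisor_iff\<close>); that is, if and only if every monomial \<open>M\<close> whose fibre contains a
multiple of \<open>x\<^sub>1\<close> has in its fibre a multiple of \<open>x\<^sub>1\<close> of degree at least \<open>deg M\<close>
(\<open>top_degree_shift_iff\<close>).

\<^emph>\<open>The five binomials.\<close> As they generate \<open>I\<close>, any two monomials of one fibre are joined by moves that
replace one term of a generator by the other (\<open>fibre_connected\<close>). Only the two terms of the fifth
generator lie in the fibre of \<open>x\<^sub>2^a\<^sub>1\<^sub>2 x\<^sub>3^a\<^sub>4\<^sub>3\<close>, so the criterion for that monomial is the inequality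
\<open>a\<^sub>1\<^sub>2 + a\<^sub>4\<^sub>3 \<le> a\<^sub>3\<^sub>1 + a\<^sub>2\<^sub>4\<close>. Now assume this inequality, and let \<open>M\<close> be a monomial of top degree that
violates the criterion. By \<open>n\<^sub>1 < n\<^sub>2 < n\<^sub>3 < n\<^sub>4\<close> the terms \<open>x\<^sub>2^a\<^sub>1\<^sub>2 x\<^sub>4^a\<^sub>1\<^sub>4\<close>, \<open>x\<^sub>3^a\<^sub>3\<close>, \<open>x\<^sub>4^a\<^sub>4\<close> and, by the
inequality, \<open>x\<^sub>2^a\<^sub>1\<^sub>2 x\<^sub>3^a\<^sub>4\<^sub>3\<close> can be replaced by multiples of \<open>x\<^sub>1\<close> without loss of degree, and replacing
\<open>x\<^sub>3^a\<^sub>2\<^sub>3 x\<^sub>4^a\<^sub>2\<^sub>4\<close> by \<open>x\<^sub>2^a\<^sub>2\<close> raises the degree. So none of these divides \<open>M\<close>, nor does \<open>x\<^sub>1\<close>. As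
the fibre of \<open>M\<close> has another member, some move applies to \<open>M\<close>, and the only one left requires
\<open>x\<^sub>2^a\<^sub>2\<close> to divide \<open>M\<close>. Then \<open>M\<close> is one of the monomials of the second condition of the theorem.\<close>

section \<open>Ideals in a commutative ring type\<close>

abbreviation type_ring :: "'a::comm_ring_1 ring" where
  "type_ring \<equiv> ring_of_type_algebra"

lemma type_ring_simps [simp]:
  "carrier type_ring = UNIV"
  "x \<otimes>\<^bsub>type_ring\<^esub> y = x * y"
  "x \<oplus>\<^bsub>type_ring\<^esub> y = x + y"
  "\<one>\<^bsub>type_ring\<^esub> = 1"
  "\<zero>\<^bsub>type_ring\<^esub> = 0"
  by (simp_all add: ring_of_type_algebra_def)

lemma cring_type_ring: "cring type_ring"
  by (rule cring_from_type_algebra)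

lemma ring_type_ring: "ring type_ring"
  by (rule ring_from_type_algebra)

lemma type_ring_inverse [simp]: "\<ominus>\<^bsub>type_ring\<^esub> y = - y"
proof -
  interpret cring "type_ring :: 'a ring" by (rule cring_type_ring)
  have "\<ominus>\<^bsub>type_ring\<^esub> y + y = 0" using l_neg[of y] by simp
  then show ?thesis by (simp add: eq_neg_iff_add_eq_0)
qed

lemma type_ring_minus [simp]: "x \<ominus>\<^bsub>type_ring\<^esub> y = x - y"
  by (simp add: a_minus_def)

text \<open>Ring-theoretic notions are stated with carriers, while the computations take place in a type of
class \<open>comm_ring_1\<close>, where ring identities can be decided by rewriting. This lemma and the ones on
quotients below pass from the former to the latter.\<close>

lemma ideal_type_ring_iff:
  "ideal I type_ring \<longleftrightarrow>
     0 \<in> I \<and> (\<forall>a\<in>I. \<forall>b\<in>I. a + b \<in> I) \<and> (\<forall>r. \<forall>a\<in>I. r * a \<in> I)"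
proof
  assume "ideal I type_ring"
  then interpret ideal I "type_ring :: 'a ring" .
  show "0 \<in> I \<and> (\<forall>a\<in>I. \<forall>b\<in>I. a + b \<in> I) \<and> (\<forall>r. \<forall>a\<in>I. r * a \<in> I)"
    using additive_subgroup.zero_closed[OF is_additive_subgroup]
      additive_subgroup.a_closed[OF is_additive_subgroup] I_l_closed by simp
next
  assume I: "0 \<in> I \<and> (\<forall>a\<in>I. \<forall>b\<in>I. a + b \<in> I) \<and> (\<forall>r. \<forall>a\<in>I. r * a \<in> I)"
  interpret R: cring "type_ring :: 'a ring" by (rule cring_type_ring)
  have neg: "- a \<in> I" if "a \<in> I" for a
  proof -
    have "(- 1) * a \<in> I" using I that by blast
    then show ?thesis by simp
  qed
  show "ideal I type_ring"
  proof (rule idealI)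
    show "subgroup I (add_monoid type_ring)"
      using I neg by (intro R.add.subgroupI) (auto simp flip: a_inv_def)
    show "a \<otimes>\<^bsub>type_ring\<^esub> r \<in> I" "r \<otimes>\<^bsub>type_ring\<^esub> a \<in> I" if "a \<in> I" for a r
      using I that by (simp_all add: mult.commute[of a r])
  qed (rule ring_type_ring)
qed

lemma ideal_type_ringD:
  assumes "ideal I type_ring"
  shows "0 \<in> I" and "a \<in> I \<Longrightarrow> b \<in> I \<Longrightarrow> a + b \<in> I" and "a \<in> I \<Longrightarrow> r * a \<in> I"
    and "a \<in> I \<Longrightarrow> a * r \<in> I" and "a \<in> I \<Longrightarrow> - a \<in> I" and "a \<in> I \<Longrightarrow> b \<in> I \<Longrightarrow> a - b \<in> I"
proof -
  note I = assms[unfolded ideal_type_ring_iff]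
  show "0 \<in> I" "a \<in> I \<Longrightarrow> b \<in> I \<Longrightarrow> a + b \<in> I" "a \<in> I \<Longrightarrow> r * a \<in> I" using I by auto
  show "a \<in> I \<Longrightarrow> a * r \<in> I" using I by (simp add: mult.commute[of a])
  have neg: "- a \<in> I" if "a \<in> I" for a
  proof -
    have "(- 1) * a \<in> I" using I that by blast
    then show ?thesis by simp
  qed
  then show "a \<in> I \<Longrightarrow> - a \<in> I" .
  show "a \<in> I \<Longrightarrow> b \<in> I \<Longrightarrow> a - b \<in> I"
    using I neg[of b] unfolding diff_conv_add_uminus by blast
qed

section \<open>Ideals of polynomials in one variable\<close>

lemma poly_ideal_principal:
  fixes A :: "'k::field poly set"
  assumes A: "ideal A type_ring"
  shows "\<exists>p. \<forall>a. a \<in> A \<longleftrightarrow> p dvd a"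
proof (cases "A \<subseteq> {0}")
  case True
  then show ?thesis using ideal_type_ringD(1)[OF A] by (intro exI[of _ 0]) auto
next
  case False
  then obtain q where "q \<in> A \<and> q \<noteq> 0" by blast
  from ex_has_least_nat[of "\<lambda>a. a \<in> A \<and> a \<noteq> 0", OF this, of degree]
  obtain p where p: "p \<in> A" "p \<noteq> 0" and min: "\<And>a. a \<in> A \<Longrightarrow> a \<noteq> 0 \<Longrightarrow> degree p \<le> degree a"
    by blast
  have "p dvd a" if "a \<in> A" for a
  proof -
    have "a mod p = a - (a div p) * p" by (simp add: minus_div_mult_eq_mod)
    then have "a mod p \<in> A" 
      using ideal_type_ringD(6)[OF A that ideal_type_ringD(3)[OF A p(1)]] by simp
    then have "a mod p = 0" using min[of "a mod p"] degree_mod_less'[OF p(2), of a] by force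
    then show ?thesis by auto
  qed
  moreover have "a \<in> A" if "p dvd a" for a
    using that ideal_type_ringD(4)[OF A p(1)] by (elim dvdE) simp
  ultimately show ?thesis by blast
qed

text \<open>Multiplication by \<open>r\<close> is injective on the finite-dimensional space \<open>K[X]/A\<close>, hence surjective. The
proof uses that \<open>A = (p)\<close> is principal: for a generator \<open>d\<close> of \<open>(p, r)\<close> the quotient \<open>p/d\<close> is mapped
into \<open>A\<close> by \<open>r\<close>, so \<open>p\<close> divides \<open>p/d\<close> and \<open>d\<close> is a unit. The lemma serves twice: for prime ideals it
shows that nonzero ones are maximal, and for regular sequences it excludes a second member.\<close>

lemma poly_ideal_comaximal:
  fixes A :: "'k::field poly set"
  assumes A: "ideal A type_ring" and "p0 \<in> A" "p0 \<noteq> 0"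
    and nzd: "\<And>a. r * a \<in> A \<Longrightarrow> a \<in> A"
  shows "\<exists>s t. s \<in> A \<and> s + r * t = 1"
proof -
  from poly_ideal_principal[OF A] obtain p where p: "\<forall>a. a \<in> A \<longleftrightarrow> p dvd a" ..
  with \<open>p0 \<in> A\<close> have "p dvd p0" by blast
  with \<open>p0 \<noteq> 0\<close> have "p \<noteq> 0" by auto
  define B where "B = {p * a + r * b |a b. True}"
  have "ideal B type_ring"
    unfolding ideal_type_ring_iff
  proof (intro conjI ballI allI)
    show "0 \<in> B" unfolding B_def by (rule CollectI, intro exI[of _ 0]) simp
  next
    fix x y assume "x \<in> B" "y \<in> B"
    then obtain a b c d where "x = p * a + r * b" "y = p * c + r * d" unfolding B_def by auto
    then have "x + y = p * (a + c) + r * (b + d)" by (simp add: algebra_simps)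
    then show "x + y \<in> B" unfolding B_def by blast
  next
    fix q x assume "x \<in> B"
    then obtain a b where "x = p * a + r * b" unfolding B_def by auto
    then have "q * x = p * (q * a) + r * (q * b)" by (simp add: algebra_simps)
    then show "q * x \<in> B" unfolding B_def by blast
  qed
  from poly_ideal_principal[OF this] obtain d where d: "\<forall>a. a \<in> B \<longleftrightarrow> d dvd a" ..
  have "p * 1 + r * 0 \<in> B" "p * 0 + r * 1 \<in> B" unfolding B_def by blast+
  then have "d dvd p" "d dvd r" using d by simp_all
  then obtain e f where e: "p = d * e" and f: "r = d * f" by (elim dvdE)
  have "r * e = p * f" using e f by simp
  then have "r * e \<in> A" using p by simp
  then have "e \<in> A" by (rule nzd)
  then have "p dvd e" using p by simp
  then obtain g where "e = p * g" by (elim dvdE)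
  with e have "p * (d * g) = p * 1" by (simp add: algebra_simps)
  with \<open>p \<noteq> 0\<close> have dg: "d * g = 1" using mult_left_cancel[of p] by blast
  have "d \<in> B" using d by simp
  then obtain a b where "d = p * a + r * b" unfolding B_def by blast
  then have "p * (a * g) + r * (b * g) = d * g" by (simp add: algebra_simps)
  with dg have "p * (a * g) + r * (b * g) = 1" by simp
  moreover have "p * (a * g) \<in> A" using p by simp
  ultimately show ?thesis by blast
qed

section \<open>Radicals and nonzerodivisors\<close>

definition ideal_radical :: "'a::comm_ring_1 set \<Rightarrow> 'a set" where
  "ideal_radical J = {f. \<exists>k. f ^ k \<in> J}"

lemma ideal_power_mono:
  assumes "ideal J type_ring" "f ^ k \<in> J" "k \<le> m"
  shows "f ^ m \<in> J"
  using assms ideal_type_ringD(4)[OF assms(1,2), of "f ^ (m - k)"]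
  by (simp flip: power_add)

lemma ideal_radical:
  assumes J: "ideal J type_ring"
  shows "ideal (ideal_radical J) type_ring"
  unfolding ideal_type_ring_iff
proof (intro conjI ballI allI)
  show "0 \<in> ideal_radical J"
    using ideal_type_ringD(1)[OF J] by (auto simp: ideal_radical_def intro!: exI[of _ 1])
next
  fix f g assume "f \<in> ideal_radical J" "g \<in> ideal_radical J"
  then obtain k l where k: "f ^ k \<in> J" and l: "g ^ l \<in> J" by (auto simp: ideal_radical_def)
  have summand: "of_nat (k + l choose i) * f ^ i * g ^ (k + l - i) \<in> J" for i
  proof (cases "k \<le> i")
    case True
    then show ?thesis using ideal_power_mono[OF J k True] ideal_type_ringD[OF J] by blast
  next
    case False
    then have "g ^ (k + l - i) \<in> J" using ideal_power_mono[OF J l] by simp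
    then show ?thesis using ideal_type_ringD[OF J] by blast
  qed
  have "(\<Sum>i\<in>S. of_nat (k + l choose i) * f ^ i * g ^ (k + l - i)) \<in> J" if "finite S" for S
    using that by induction (use summand ideal_type_ringD[OF J] in auto)
  then have "(f + g) ^ (k + l) \<in> J" by (simp add: binomial_ring)
  then show "f + g \<in> ideal_radical J" by (auto simp: ideal_radical_def)
next
  fix r f assume "f \<in> ideal_radical J"
  then show "r * f \<in> ideal_radical J"
    using ideal_type_ringD(3)[OF J] by (auto simp: ideal_radical_def power_mult_distrib)
qed

lemma ideal_plus_principal:
  assumes J: "ideal J type_ring"
  shows "ideal {f. \<exists>c. f - y * c \<in> J} type_ring" and "J \<subseteq> {f. \<exists>c. f - y * c \<in> J}"
proof -
  note R = ideal_type_ringD[OF J]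
  show sub: "J \<subseteq> {f. \<exists>c. f - y * c \<in> J}"
  proof
    fix f assume "f \<in> J"
    then have "f - y * 0 \<in> J" by simp
    then show "f \<in> {f. \<exists>c. f - y * c \<in> J}" by blast
  qed
  show "ideal {f. \<exists>c. f - y * c \<in> J} type_ring"
    unfolding ideal_type_ring_iff
  proof (intro conjI ballI allI)
    show "0 \<in> {f. \<exists>c. f - y * c \<in> J}" using R(1) sub by blast
  next
    fix a b assume "a \<in> {f. \<exists>c. f - y * c \<in> J}" "b \<in> {f. \<exists>c. f - y * c \<in> J}"
    then obtain c d where "a - y * c \<in> J" "b - y * d \<in> J" by blast
    then have "(a - y * c) + (b - y * d) \<in> J" by (rule R(2))
    moreover have "(a - y * c) + (b - y * d) = (a + b) - y * (c + d)" by (simp add: algebra_simps)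
    ultimately have "(a + b) - y * (c + d) \<in> J" by simp
    then show "a + b \<in> {f. \<exists>c. f - y * c \<in> J}" by blast
  next
    fix r a assume "a \<in> {f. \<exists>c. f - y * c \<in> J}"
    then obtain c where "a - y * c \<in> J" by blast
    then have "r * (a - y * c) \<in> J" by (rule R(3))
    moreover have "r * (a - y * c) = r * a - y * (r * c)" by (simp add: algebra_simps)
    ultimately have "r * a - y * (r * c) \<in> J" by simp
    then show "r * a \<in> {f. \<exists>c. f - y * c \<in> J}" by blast
  qed
qed

text \<open>Modulo \<open>J\<close> the element \<open>h\<close> is \<open>g\<close> plus a nilpotent \<open>h - g\<close>, and \<open>h\<^sup>M - (h - g)\<^sup>M\<close> is divisible by
\<open>h - (h - g) = g\<close>. This is how nilpotents are disposed of throughout.\<close>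

lemma radical_diff_power:
  assumes "h - g \<in> ideal_radical J"
  shows "\<exists>M c. h ^ M - g * c \<in> J"
proof -
  obtain M where M: "(h - g) ^ M \<in> J" using assms by (auto simp: ideal_radical_def)
  have "h ^ M - (h - g) ^ M = (h - (h - g)) * (\<Sum>i<M. (h - g) ^ (M - Suc i) * h ^ i)"
    by (rule power_diff_sumr2)
  then have "(h - g) ^ M = h ^ M - g * (\<Sum>i<M. (h - g) ^ (M - Suc i) * h ^ i)" 
    by (simp add: algebra_simps)
  with M show ?thesis by metis
qed

lemma nonzerodivisor_power:
  fixes y :: "'a::comm_ring_1"
  assumes "\<And>r. y * r \<in> I \<Longrightarrow> r \<in> I" "y ^ M * r \<in> I"
  shows "r \<in> I"
  using assms(2) by (induction M) (use assms(1) in \<open>auto simp: mult.assoc\<close>)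

section \<open>Quotients of a commutative ring type\<close>

lemma quot_carrier: 
  "carrier (type_ring Quot J) = range ((+>\<^bsub>type_ring\<^esub>) J)"
  by (auto simp: FactRing_def A_RCOSETS_def')

lemma quot_ring_hom:
  assumes "ideal J type_ring"
  shows "ring_hom_cring type_ring (type_ring Quot J) ((+>\<^bsub>type_ring\<^esub>) J)"
  by (rule ideal.rcos_ring_hom_cring[OF assms cring_type_ring])

lemma quot_eq_iff:
  assumes "ideal J type_ring"
  shows "J +>\<^bsub>type_ring\<^esub> f = J +>\<^bsub>type_ring\<^esub> g \<longleftrightarrow> f - g \<in> J"
  using ring.quotient_eq_iff_same_a_r_cos[OF ring_type_ring assms, of f g] by auto

lemma quot_simps:
  assumes J: "ideal J type_ring"
  shows "(J +>\<^bsub>type_ring\<^esub> f) \<otimes>\<^bsub>type_ring Quot J\<^esub> (J +>\<^bsub>type_ring\<^esub> g) = J +>\<^bsub>type_ring\<^esub> (f * g)"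
    and "(J +>\<^bsub>type_ring\<^esub> f) \<oplus>\<^bsub>type_ring Quot J\<^esub> (J +>\<^bsub>type_ring\<^esub> g) = J +>\<^bsub>type_ring\<^esub> (f + g)"
    and "\<zero>\<^bsub>type_ring Quot J\<^esub> = J +>\<^bsub>type_ring\<^esub> 0"
    and "\<one>\<^bsub>type_ring Quot J\<^esub> = J +>\<^bsub>type_ring\<^esub> 1"
proof -
  interpret h: ring_hom_cring type_ring "type_ring Quot J" "(+>\<^bsub>type_ring\<^esub>) J"
    by (rule quot_ring_hom[OF J])
  show "(J +>\<^bsub>type_ring\<^esub> f) \<otimes>\<^bsub>type_ring Quot J\<^esub> (J +>\<^bsub>type_ring\<^esub> g) = J +>\<^bsub>type_ring\<^esub> (f * g)"
    using h.hom_mult[of f g] by simp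
  show "(J +>\<^bsub>type_ring\<^esub> f) \<oplus>\<^bsub>type_ring Quot J\<^esub> (J +>\<^bsub>type_ring\<^esub> g) = J +>\<^bsub>type_ring\<^esub> (f + g)"
    using h.hom_add[of f g] by simp
  show "\<zero>\<^bsub>type_ring Quot J\<^esub> = J +>\<^bsub>type_ring\<^esub> 0" using h.hom_zero by simp
  show "\<one>\<^bsub>type_ring Quot J\<^esub> = J +>\<^bsub>type_ring\<^esub> 1" using h.hom_one by simp
qed

lemma quot_ideal_vimage:
  assumes J: "ideal J type_ring" and Q: "ideal Q (type_ring Quot J)"
  shows "ideal {f. J +>\<^bsub>type_ring\<^esub> f \<in> Q} type_ring" "J \<subseteq> {f. J +>\<^bsub>type_ring\<^esub> f \<in> Q}"
proof -
  show "ideal {f. J +>\<^bsub>type_ring\<^esub> f \<in> Q} type_ring"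
    using ring_hom_ring.ideal_vimage[OF ideal.rcos_ring_hom_ring[OF J] Q] by simp
  interpret Q: ideal Q "type_ring Quot J" by (rule Q)
  show "J \<subseteq> {f. J +>\<^bsub>type_ring\<^esub> f \<in> Q}"
  proof
    fix f assume "f \<in> J"
    then have "J +>\<^bsub>type_ring\<^esub> f = J +>\<^bsub>type_ring\<^esub> 0" using quot_eq_iff[OF J] by simp
    then show "f \<in> {f. J +>\<^bsub>type_ring\<^esub> f \<in> Q}"
      using Q.additive_subgroup_axioms[THEN additive_subgroup.zero_closed] quot_simps(3)[OF J] by simp
  qed
qed

lemma quot_ideal_image:
  assumes J: "ideal J type_ring" and I: "ideal I type_ring" and JI: "J \<subseteq> I"
  shows "ideal ((+>\<^bsub>type_ring\<^esub>) J ` I) (type_ring Quot J)"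
    and "J +>\<^bsub>type_ring\<^esub> f \<in> (+>\<^bsub>type_ring\<^esub>) J ` I \<longleftrightarrow> f \<in> I"
proof -
  show "ideal ((+>\<^bsub>type_ring\<^esub>) J ` I) (type_ring Quot J)"
    by (rule ring.ring_ideal_imp_quot_ideal[OF ring_type_ring J I])
  show "J +>\<^bsub>type_ring\<^esub> f \<in> (+>\<^bsub>type_ring\<^esub>) J ` I \<longleftrightarrow> f \<in> I"
  proof
    assume "J +>\<^bsub>type_ring\<^esub> f \<in> (+>\<^bsub>type_ring\<^esub>) J ` I"
    then obtain g where "g \<in> I" "f - g \<in> J" using quot_eq_iff[OF J] by auto
    then have "(f - g) + g \<in> I" using ideal_type_ringD(2)[OF I] JI by blast
    then show "f \<in> I" by simp
  qed auto
qed

lemma quot_primeideal_vimage: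
  assumes J: "ideal J type_ring" and Q: "primeideal Q (type_ring Quot J)"
  shows "primeideal {f. J +>\<^bsub>type_ring\<^esub> f \<in> Q} type_ring"
  using ring_hom_ring.primeideal_vimage[OF ideal.rcos_ring_hom_ring[OF J] cring_type_ring Q] by simp

text \<open>The first two conditions on a regular sequence refer to the ideals generated by no member and by one
member; this lemma and the next translate them into conditions on representatives modulo \<open>J\<close>.\<close>

lemma quot_genideal_empty:
  assumes J: "ideal J type_ring"
  shows "J +>\<^bsub>type_ring\<^esub> f \<in> Idl\<^bsub>type_ring Quot J\<^esub> {} \<longleftrightarrow> f \<in> J"
proof -
  interpret h: ring_hom_cring type_ring "type_ring Quot J" "(+>\<^bsub>type_ring\<^esub>) J"
    by (rule quot_ring_hom[OF J])
  have "Idl\<^bsub>type_ring Quot J\<^esub> {} \<subseteq> {\<zero>\<^bsub>type_ring Quot J\<^esub>}"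
    by (rule h.S.genideal_minimal[OF h.S.zeroideal]) simp
  moreover have "\<zero>\<^bsub>type_ring Quot J\<^esub> \<in> Idl\<^bsub>type_ring Quot J\<^esub> {}"
    using h.S.genideal_ideal[of "{}"] additive_subgroup.zero_closed ideal.axioms(1) by fastforce
  ultimately have "Idl\<^bsub>type_ring Quot J\<^esub> {} = {\<zero>\<^bsub>type_ring Quot J\<^esub>}" by auto
  then show ?thesis using quot_simps(3)[OF J] quot_eq_iff[OF J] by simp
qed

lemma quot_genideal_single:
  assumes J: "ideal J type_ring"
  shows "J +>\<^bsub>type_ring\<^esub> f \<in> Idl\<^bsub>type_ring Quot J\<^esub> {J +>\<^bsub>type_ring\<^esub> y} \<longleftrightarrow> (\<exists>c. f - y * c \<in> J)"
proof -
  interpret h: ring_hom_cring type_ring "type_ring Quot J" "(+>\<^bsub>type_ring\<^esub>) J"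
    by (rule quot_ring_hom[OF J])
  have "J +>\<^bsub>type_ring\<^esub> y \<in> carrier (type_ring Quot J)" by (simp add: quot_carrier)
  then have "Idl\<^bsub>type_ring Quot J\<^esub> {J +>\<^bsub>type_ring\<^esub> y} = range (\<lambda>c. J +>\<^bsub>type_ring\<^esub> (c * y))"
    by (simp add: h.S.cgenideal_eq_genideal[symmetric] cgenideal_def quot_carrier)
      (auto simp: quot_simps[OF J] intro!: exI[of _ "J +>\<^bsub>type_ring\<^esub> c" for c])
  then show ?thesis by (auto simp: quot_eq_iff[OF J] mult.commute[of y])
qed

lemma quot_maximalideal_image:
  assumes J: "ideal J type_ring" and M: "maximalideal M type_ring" and JM: "J \<subseteq> M"
  shows "maximalideal ((+>\<^bsub>type_ring\<^esub>) J ` M) (type_ring Quot J)"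
proof -
  have idM: "ideal M type_ring" using M by (simp add: maximalideal_def)
  note mem = quot_ideal_image(2)[OF J idM JM]
  show ?thesis
  proof (rule maximalidealI)
    show "ideal ((+>\<^bsub>type_ring\<^esub>) J ` M) (type_ring Quot J)"
      by (rule quot_ideal_image(1)[OF J idM JM])
    show "carrier (type_ring Quot J) \<noteq> (+>\<^bsub>type_ring\<^esub>) J ` M"
    proof
      assume "carrier (type_ring Quot J) = (+>\<^bsub>type_ring\<^esub>) J ` M"
      then have "M = UNIV" using mem by (metis UNIV_eq_I quot_carrier rangeI)
      then show False using maximalideal.I_notcarr[OF M] by simp
    qed
  next
    fix K assume K: "ideal K (type_ring Quot J)" and MK: "(+>\<^bsub>type_ring\<^esub>) J ` M \<subseteq> K"
      and Kc: "K \<subseteq> carrier (type_ring Quot J)"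
    let ?V = "{f. J +>\<^bsub>type_ring\<^esub> f \<in> K}"
    have "?V = M \<or> ?V = carrier type_ring"
      by (rule maximalideal.I_maximal[OF M quot_ideal_vimage(1)[OF J K]]) (use MK in auto)
    moreover have "K = (+>\<^bsub>type_ring\<^esub>) J ` ?V" using Kc by (auto simp: quot_carrier)
    ultimately show "K = (+>\<^bsub>type_ring\<^esub>) J ` M \<or> K = carrier (type_ring Quot J)"
      by (auto simp: quot_carrier)
  qed
qed

section \<open>Submodules of finitely generated modules over polynomials\<close>

text \<open>Submodules are finitely generated because \<open>K[X]\<close> is a principal ideal domain: the coefficients
of \<open>e\<close> that occur in elements of \<open>M\<close> form an ideal \<open>(p)\<close>, and one element of \<open>M\<close> with coefficient
\<open>p\<close> reduces all others to the span of the remaining generators. Working relative to \<open>J\<close> makes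
the statement applicable to the quotient by \<open>J\<close> without forming it.\<close>

lemma finitely_generated_submodule:
  fixes scale :: "'k::field poly \<Rightarrow> 'b::ab_group_add \<Rightarrow> 'b"
  assumes "Modules.module scale" and "finite E" and J: "module.subspace scale J"
    and "module.subspace scale M" "J \<subseteq> M" "M \<subseteq> module.span scale (E \<union> J)"
  shows "\<exists>T. finite T \<and> T \<subseteq> M \<and> M \<subseteq> module.span scale (T \<union> J)"
proof -
  interpret Modules.module scale by fact
  show ?thesis
    using assms(2,4-)
  proof (induction E arbitrary: M)
    case empty
    then show ?case by (intro exI[of _ "{}"]) auto
  next
    case (insert e E)
    note M = \<open>subspace M\<close>
    let ?U = "span (E \<union> J)"
    define A where "A = {p. \<exists>m\<in>M. m - scale p e \<in> ?U}"
    have "ideal A type_ring"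
      unfolding ideal_type_ring_iff
    proof (intro conjI ballI allI)
      show "0 \<in> A" unfolding A_def using subspace_0[OF M] span_zero by force
    next
      fix p q assume "p \<in> A" "q \<in> A"
      then obtain m m' where m: "m \<in> M" "m - scale p e \<in> ?U" "m' \<in> M" "m' - scale q e \<in> ?U"
        unfolding A_def by auto
      have "(m + m') - scale (p + q) e = (m - scale p e) + (m' - scale q e)"
        by (simp add: scale_left_distrib)
      then have "(m + m') - scale (p + q) e \<in> ?U" using m span_add by metis
      then show "p + q \<in> A" unfolding A_def using subspace_add[OF M m(1,3)] by blast
    next
      fix r p assume "p \<in> A"
      then obtain m where m: "m \<in> M" "m - scale p e \<in> ?U" unfolding A_def by auto
      have "scale r m - scale (r * p) e = scale r (m - scale p e)"
        by (simp add: scale_right_diff_distrib)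
      then have "scale r m - scale (r * p) e \<in> ?U" using m span_scale by metis
      then show "r * p \<in> A" unfolding A_def using subspace_scale[OF M m(1)] by blast
    qed
    from poly_ideal_principal[OF this] obtain p where p: "\<forall>a. a \<in> A \<longleftrightarrow> p dvd a" ..
    then have "p \<in> A" by simp
    then obtain m0 where m0: "m0 \<in> M" "m0 - scale p e \<in> ?U" unfolding A_def by auto
    have "J \<subseteq> ?U" using span_superset by blast
    then have "\<exists>T. finite T \<and> T \<subseteq> M \<inter> ?U \<and> M \<inter> ?U \<subseteq> span (T \<union> J)"
      by (intro insert.IH subspace_inter) (use insert.prems in auto)
    then obtain T where T: "finite T" "T \<subseteq> M" "M \<inter> ?U \<subseteq> span (T \<union> J)" by auto
    have "m \<in> span (insert m0 T \<union> J)" if "m \<in> M" for m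
    proof -
      from that insert.prems(3) have "m \<in> span (insert e (E \<union> J))" by auto
      then obtain k where k: "m - scale k e \<in> ?U" unfolding span_breakdown_eq by blast
      with that have "k \<in> A" unfolding A_def by blast
      with p have "p dvd k" by blast
      then obtain c where "k = p * c" by (elim dvdE)
      then have c: "k = c * p" by (simp only: mult.commute)
      have "m - scale c m0 = (m - scale k e) - scale c (m0 - scale p e)"
        by (simp add: c scale_right_diff_distrib)
      then have "m - scale c m0 \<in> ?U" using k m0(2) span_diff span_scale by metis
      moreover have "m - scale c m0 \<in> M" using that m0(1) M subspace_diff subspace_scale by blast
      ultimately have "m - scale c m0 \<in> span (T \<union> J)" using T(3) by blast
      then have "m \<in> span (insert m0 (T \<union> J))" unfolding span_breakdown_eq by blast
      then show ?thesis by simp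
    qed
    then show ?case using T m0(1) by (intro exI[of _ "insert m0 T"]) auto
  qed
qed

section \<open>Nilpotent thickenings of the affine line\<close>

text \<open>The quotient of the ambient ring by \<open>J\<close> is a ring whose reduction is the polynomial ring
\<open>K[X]\<close>, embedded by \<open>emb\<close>. The last two assumptions say that \<open>emb\<close> is onto and injective modulo the
radical of \<open>J\<close>.\<close>

locale thickened_line =
  fixes J :: "'a::comm_ring_1 set" and emb :: "'k::field poly \<Rightarrow> 'a"
  assumes ideal_J: "ideal J type_ring"
    and emb_add: "emb (p + q) = emb p + emb q"
    and emb_mult: "emb (p * q) = emb p * emb q"
    and emb_1: "emb 1 = 1"
    and reduced: "\<exists>p. f - emb p \<in> ideal_radical J"
    and faithful: "emb p \<in> ideal_radical J \<Longrightarrow> p = 0"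
begin

lemma emb_0: "emb 0 = 0"
  using emb_add[of 0 0] by simp

lemma emb_diff: "emb (p - q) = emb p - emb q"
  using emb_add[of "p - q" q] by (simp add: algebra_simps)

lemmas radical = ideal_radical[OF ideal_J]

lemma J_subset_radical: "J \<subseteq> ideal_radical J"
proof
  fix f assume "f \<in> J"
  then have "f ^ 1 \<in> J" by simp
  then show "f \<in> ideal_radical J" unfolding ideal_radical_def by blast
qed

lemma one_notin_radical: "1 \<notin> ideal_radical J"
  using faithful[of 1] emb_1 by auto

lemma emb_vimage_ideal:
  assumes "ideal I type_ring"
  shows "ideal {p. emb p \<in> I} type_ring"
  using ideal_type_ringD[OF assms]
  by (auto simp: ideal_type_ring_iff emb_0 emb_add emb_mult)

lemma radical_subset_prime:
  assumes P: "primeideal P type_ring" and JP: "J \<subseteq> P"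
  shows "ideal_radical J \<subseteq> P"
proof
  interpret P: primeideal P type_ring by (rule P)
  fix f assume "f \<in> ideal_radical J"
  then obtain k where "f ^ k \<in> P" using JP by (auto simp: ideal_radical_def)
  then show "f \<in> P"
  proof (induction k)
    case 0
    then show ?case using P.one_imp_carrier P.I_notcarr by simp
  next
    case (Suc k)
    then show ?case using P.I_prime[of f "f ^ k"] by auto
  qed
qed

text \<open>All primes contain the nilpotents, so a chain of primes restricts to a strict chain in \<open>K[X]\<close>, in
which a nonzero prime ideal is maximal.\<close>

lemma no_prime_chain:
  assumes "primeideal P0 type_ring" "primeideal P1 type_ring" "primeideal P2 type_ring"
    and "J \<subseteq> P0" "P0 \<subset> P1" "P1 \<subset> P2"
  shows False
proof -
  interpret P0: primeideal P0 "type_ring :: 'a ring" by fact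
  interpret P1: primeideal P1 "type_ring :: 'a ring" by fact
  interpret P2: primeideal P2 "type_ring :: 'a ring" by fact
  note I0 = ideal_type_ringD[OF P0.is_ideal]
  note I1 = ideal_type_ringD[OF P1.is_ideal]
  note I2 = ideal_type_ringD[OF P2.is_ideal]
  have N: "ideal_radical J \<subseteq> P0" using radical_subset_prime assms by blast
  obtain f where f: "f \<in> P1" "f \<notin> P0" using \<open>P0 \<subset> P1\<close> by blast
  obtain p where p: "f - emb p \<in> P0" using reduced N by blast
  have "p \<noteq> 0" using p f emb_0 by auto
  have "f - (f - emb p) \<in> P1" using I1(6)[OF f(1)] p \<open>P0 \<subset> P1\<close> by blast
  then have pP1: "emb p \<in> P1" by simp
  obtain g where g: "g \<in> P2" "g \<notin> P1" using \<open>P1 \<subset> P2\<close> by blast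
  obtain q where q: "g - emb q \<in> P0" using reduced N by blast
  have qP1: "emb q \<notin> P1"
  proof
    assume "emb q \<in> P1"
    then have "(g - emb q) + emb q \<in> P1" using q I1(2) \<open>P0 \<subset> P1\<close> by blast
    with g show False by simp
  qed
  have "g - (g - emb q) \<in> P2" using I2(6)[OF g(1)] q \<open>P0 \<subset> P1\<close> \<open>P1 \<subset> P2\<close> by blast
  then have qP2: "emb q \<in> P2" by simp
  have "\<exists>s t. s \<in> {p. emb p \<in> P1} \<and> s + q * t = 1"
  proof (rule poly_ideal_comaximal[OF emb_vimage_ideal[OF P1.is_ideal]])
    fix a assume "q * a \<in> {p. emb p \<in> P1}"
    then show "a \<in> {p. emb p \<in> P1}" using P1.I_prime[of "emb q" "emb a"] qP1 by (auto simp: emb_mult)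
  qed (use pP1 \<open>p \<noteq> 0\<close> in auto)
  then obtain s t where s: "emb s \<in> P1" "s + q * t = 1" by auto
  then have "emb s + emb q * emb t = 1" using emb_1 by (simp flip: emb_add emb_mult)
  moreover have "emb s + emb q * emb t \<in> P2"
    using s(1) qP2 I2(2,4) \<open>P1 \<subset> P2\<close> by blast
  ultimately show False using P2.one_imp_carrier P2.I_notcarr by simp
qed

lemma primeideal_radical: "primeideal (ideal_radical J) type_ring"
proof (rule primeidealI[OF radical cring_type_ring])
  show "carrier type_ring \<noteq> ideal_radical J" using one_notin_radical by auto
next
  note N = ideal_type_ringD[OF radical]
  fix f g assume "f \<otimes>\<^bsub>type_ring\<^esub> g \<in> ideal_radical J"
  then have fg: "f * g \<in> ideal_radical J" by simp
  obtain p where p: "f - emb p \<in> ideal_radical J" using reduced by blast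
  obtain q where q: "g - emb q \<in> ideal_radical J" using reduced by blast
  have "f * g - (f - emb p) * g - emb p * (g - emb q) \<in> ideal_radical J"
    by (intro N(6) N(4)[OF p] N(3)[OF q] fg)
  moreover have "f * g - (f - emb p) * g - emb p * (g - emb q) = emb (p * q)"
    by (simp add: emb_mult algebra_simps)
  ultimately have "emb (p * q) \<in> ideal_radical J" by metis
  then have "p * q = 0" by (rule faithful)
  then consider "p = 0" | "q = 0" by auto
  then show "f \<in> ideal_radical J \<or> g \<in> ideal_radical J" by cases (use p q emb_0 in simp_all)
qed

lemma primeideal_radical_image:
  "primeideal ((+>\<^bsub>type_ring\<^esub>) J ` ideal_radical J) (type_ring Quot J)"
proof -
  interpret N: primeideal "ideal_radical J" type_ring by (rule primeideal_radical)
  note mem = quot_ideal_image(2)[OF ideal_J radical J_subset_radical]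
  interpret Q: cring "type_ring Quot J" by (rule ideal.quotient_is_cring[OF ideal_J cring_type_ring])
  show ?thesis
  proof (rule primeidealI[OF quot_ideal_image(1)[OF ideal_J radical J_subset_radical] Q.is_cring])
    have "J +>\<^bsub>type_ring\<^esub> 1 \<notin> (+>\<^bsub>type_ring\<^esub>) J ` ideal_radical J"
      using mem one_notin_radical by blast
    moreover have "J +>\<^bsub>type_ring\<^esub> 1 \<in> carrier (type_ring Quot J)" by (simp add: quot_carrier)
    ultimately show "carrier (type_ring Quot J) \<noteq> (+>\<^bsub>type_ring\<^esub>) J ` ideal_radical J"
      by blast
  next
    fix a b assume "a \<in> carrier (type_ring Quot J)" "b \<in> carrier (type_ring Quot J)"
      and ab: "a \<otimes>\<^bsub>type_ring Quot J\<^esub> b \<in> (+>\<^bsub>type_ring\<^esub>) J ` ideal_radical J"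
    then obtain f g where fg: "a = J +>\<^bsub>type_ring\<^esub> f" "b = J +>\<^bsub>type_ring\<^esub> g"
      unfolding quot_carrier by blast
    have "f * g \<in> ideal_radical J" using ab unfolding fg quot_simps[OF ideal_J] mem .
    then have "f \<in> ideal_radical J \<or> g \<in> ideal_radical J" using N.I_prime[of f g] by simp
    then show "a \<in> (+>\<^bsub>type_ring\<^esub>) J ` ideal_radical J \<or> b \<in> (+>\<^bsub>type_ring\<^esub>) J ` ideal_radical J"
      using fg by blast
  qed
qed

text \<open>The inclusion is strict because the radical is not maximal: it is properly contained in the ideal
obtained by adding the coordinate \<open>X\<close>, and that ideal does not contain \<open>1\<close>.\<close>

lemma radical_psubset_maximal:
  assumes P: "maximalideal P (type_ring Quot J)"
  shows "ideal_radical J \<subset> {f. J +>\<^bsub>type_ring\<^esub> f \<in> P}"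
proof -
  let ?V = "{f. J +>\<^bsub>type_ring\<^esub> f \<in> P}"
  interpret Q: cring "type_ring Quot J" by (rule ideal.quotient_is_cring[OF ideal_J cring_type_ring])
  interpret P: maximalideal P "type_ring Quot J" by (rule P)
  have prime: "primeideal ?V type_ring"
    by (rule quot_primeideal_vimage[OF ideal_J Q.maximalideal_prime[OF P]])
  have N: "ideal_radical J \<subseteq> ?V"
    by (rule radical_subset_prime[OF prime quot_ideal_vimage(2)[OF ideal_J P.is_ideal]])
  have "ideal_radical J \<noteq> ?V"
  proof
    assume eq: "ideal_radical J = ?V"
    define z where "z = emb [:0, 1:]"
    define I where "I = {f. \<exists>c. f - z * c \<in> ideal_radical J}"
    note R = ideal_type_ringD[OF radical]
    have I: "ideal I type_ring" and NI: "ideal_radical J \<subseteq> I"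
      unfolding I_def by (rule ideal_plus_principal[OF radical])+
    have JI: "J \<subseteq> I" using J_subset_radical NI by blast
    note mem = quot_ideal_image(2)[OF ideal_J I JI]
    have "P \<subseteq> (+>\<^bsub>type_ring\<^esub>) J ` I"
    proof
      fix a assume "a \<in> P"
      moreover then obtain f where "a = J +>\<^bsub>type_ring\<^esub> f"
        using P.a_subset unfolding quot_carrier by blast
      ultimately show "a \<in> (+>\<^bsub>type_ring\<^esub>) J ` I" using eq NI by blast
    qed
    moreover have "(+>\<^bsub>type_ring\<^esub>) J ` I \<subseteq> carrier (type_ring Quot J)" by (auto simp: quot_carrier)
    ultimately have "(+>\<^bsub>type_ring\<^esub>) J ` I = P \<or> (+>\<^bsub>type_ring\<^esub>) J ` I = carrier (type_ring Quot J)"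
      using P.I_maximal[OF quot_ideal_image(1)[OF ideal_J I JI]] by blast
    moreover have "I = {f. J +>\<^bsub>type_ring\<^esub> f \<in> (+>\<^bsub>type_ring\<^esub>) J ` I}" using mem by blast
    ultimately have "I = ?V \<or> I = UNIV" by (auto simp: quot_carrier)
    then show False
    proof
      assume "I = ?V"
      moreover have "z - z * 1 \<in> ideal_radical J" using R(1) by simp
      then have "z \<in> I" unfolding I_def by blast
      ultimately have "z \<in> ideal_radical J" using eq by simp
      then show False using faithful[of "[:0, 1:]"] unfolding z_def by simp
    next
      assume "I = UNIV"
      then obtain c where c: "1 - z * c \<in> ideal_radical J" unfolding I_def by blast
      obtain q where q: "c - emb q \<in> ideal_radical J" using reduced by blast
      have "(1 - z * c) + z * (c - emb q) \<in> ideal_radical J" using c q R(2,3) by blast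
      moreover have "emb (1 - [:0, 1:] * q) = 1 - z * emb q"
        by (simp only: emb_diff emb_mult emb_1 z_def)
      then have "(1 - z * c) + z * (c - emb q) = emb (1 - [:0, 1:] * q)"
        by (simp add: algebra_simps)
      ultimately have "emb (1 - [:0, 1:] * q) \<in> ideal_radical J" by metis
      then have "1 - [:0, 1:] * q = 0" by (rule faithful)
      then have "poly (1 - [:0, 1:] * q) 0 = poly 0 0" by simp
      then show False by simp
    qed
  qed
  with N show ?thesis by blast
qed

lemma codimension_maximal:
  assumes P: "maximalideal P (type_ring Quot J)"
  shows "codimension (type_ring Quot J) P = 1"
proof (rule antisym)
  interpret Q: cring "type_ring Quot J" by (rule ideal.quotient_is_cring[OF ideal_J cring_type_ring])
  let ?V = "\<lambda>Q. {f. J +>\<^bsub>type_ring\<^esub> f \<in> Q}"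
  show "codimension (type_ring Quot J) P \<le> 1"
    unfolding codimension_def
  proof (rule Sup_least, clarify)
    fix k and C :: "nat \<Rightarrow> 'a set set"
    assume prime: "\<forall>i\<le>k. primeideal (C i) (type_ring Quot J)" and strict: "\<forall>i<k. C i \<subset> C (Suc i)"
    show "enat k \<le> 1"
    proof (rule ccontr)
      assume "\<not> enat k \<le> 1"
      then have k: "2 \<le> k" by (simp add: one_enat_def)
      have pr: "primeideal (?V (C i)) type_ring" if "i \<le> k" for i
        using quot_primeideal_vimage[OF ideal_J] prime that by blast
      have st: "?V (C i) \<subset> ?V (C (Suc i))" if "i < k" for i
      proof -
        have "ideal (C (Suc i)) (type_ring Quot J)"
          using prime that unfolding primeideal_def by simp
        then have "C (Suc i) \<subseteq> range ((+>\<^bsub>type_ring\<^esub>) J)"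
          using additive_subgroup.a_subset[of "C (Suc i)" "type_ring Quot J"]
          by (simp add: quot_carrier ideal_def)
        moreover have "C i \<subset> C (Suc i)" using strict that by blast
        ultimately show ?thesis by blast
      qed
      have "J \<subseteq> ?V (C 0)"
        using quot_ideal_vimage(2)[OF ideal_J] prime k unfolding primeideal_def by blast
      then show False
        using no_prime_chain[OF pr[of 0] pr[of 1] pr[of 2]] st[of 0] st[of 1] k
        by (simp add: numeral_2_eq_2)
    qed
  qed
next
  \<comment> \<open>The chain of length \<open>1\<close> starts at the nilradical.\<close>
  let ?N = "(+>\<^bsub>type_ring\<^esub>) J ` ideal_radical J"
  have lt: "?N \<subset> P"
    using radical_psubset_maximal[OF P]
      quot_ideal_image(2)[OF ideal_J radical J_subset_radical] by blast
  define C where "C i = (if i = 0 then ?N else P)" for i :: nat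
  interpret Q: cring "type_ring Quot J" by (rule ideal.quotient_is_cring[OF ideal_J cring_type_ring])
  have "\<exists>C :: nat \<Rightarrow> 'a set set. (\<forall>i\<le>1. primeideal (C i) (type_ring Quot J)) \<and>
      (\<forall>i<1. C i \<subset> C (Suc i)) \<and> C 1 = P"
    using primeideal_radical_image Q.maximalideal_prime[OF P] lt
    by (intro exI[of _ C]) (auto simp: C_def)
  then show "1 \<le> codimension (type_ring Quot J) P"
    unfolding codimension_def one_enat_def by (intro Sup_upper) blast
qed

text \<open>The polynomials \<open>p\<close> with \<open>emb p\<close> in \<open>(y\<^sub>1) + J\<close> form an ideal \<open>A\<close> of \<open>K[X]\<close>. It is nonzero, since
\<open>y\<^sub>1\<close> is not nilpotent. If \<open>r\<close> is the polynomial that represents \<open>y\<^sub>2\<close>, then \<open>r\<close> acts injectively on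
\<open>K[X]/A\<close>, because a power of \<open>y\<^sub>2\<close> is a multiple of \<open>emb r\<close>. Therefore \<open>A\<close> and \<open>r\<close> are comaximal, and
so are \<open>y\<^sub>1\<close> and \<open>y\<^sub>2\<close> up to a nilpotent.\<close>

lemma regular_pair_generates:
  assumes nzd1: "\<And>r. y1 * r \<in> J \<Longrightarrow> r \<in> J"
    and nzd2: "\<And>r c. y2 * r - y1 * c \<in> J \<Longrightarrow> \<exists>d. r - y1 * d \<in> J"
  shows "\<exists>a b. 1 - (y1 * a + y2 * b) \<in> J"
proof -
  note R = ideal_type_ringD[OF ideal_J]
  note N = ideal_type_ringD[OF radical]
  define I where "I = {f. \<exists>c. f - y1 * c \<in> J}"
  have II: "ideal I type_ring" unfolding I_def by (rule ideal_plus_principal(1)[OF ideal_J])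
  have JI: "f \<in> I" if "f \<in> J" for f
    using ideal_plus_principal(2)[OF ideal_J] that unfolding I_def by (rule subsetD)
  have nzdI: "r \<in> I" if r: "y2 * r \<in> I" for r
  proof -
    obtain c where "y2 * r - y1 * c \<in> J" using r unfolding I_def by blast
    then have "\<exists>d. r - y1 * d \<in> J" by (rule nzd2)
    then show ?thesis unfolding I_def by blast
  qed
  obtain q where q: "y1 - emb q \<in> ideal_radical J" using reduced by blast
  obtain r where r: "y2 - emb r \<in> ideal_radical J" using reduced by blast
  show ?thesis
  proof (cases "q = 0")
    case True
    then obtain k where "y1 ^ k \<in> J" using q emb_0 by (auto simp: ideal_radical_def)
    then have "y1 ^ k * 1 \<in> J" by simp
    then have "1 \<in> J" by (rule nonzerodivisor_power[of y1 J, rotated]) (rule nzd1)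
    then have "1 * (1 - (y1 * 0 + y2 * 0)) \<in> J" by (rule R(4))
    then have "1 - (y1 * 0 + y2 * 0) \<in> J" by simp
    then show ?thesis by blast
  next
    case False
    have "- 1 * (y1 - emb q) \<in> ideal_radical J" by (rule N(3)[OF q])
    then have "emb q - y1 \<in> ideal_radical J" by simp
    from radical_diff_power[OF this] obtain M c where "emb q ^ M - y1 * c \<in> J" by blast
    then have qM: "emb q ^ M \<in> I" unfolding I_def by blast
    have emb_power: "emb (q ^ M) = emb q ^ M" for M
      by (induction M) (simp_all add: emb_1 emb_mult)
    obtain L e where L: "y2 ^ L - emb r * e \<in> J" using radical_diff_power[OF r] by blast
    have "\<exists>s t. s \<in> {p. emb p \<in> I} \<and> s + r * t = 1"
    proof (rule poly_ideal_comaximal[OF emb_vimage_ideal[OF II]])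
      show "q ^ M \<in> {p. emb p \<in> I}" using qM emb_power by simp
      show "q ^ M \<noteq> 0" using False by simp
    next
      fix a assume "r * a \<in> {p. emb p \<in> I}"
      then have "emb r * emb a \<in> I" by (simp add: emb_mult)
      then have "e * (emb r * emb a) \<in> I" by (rule ideal_type_ringD(3)[OF II])
      moreover have "emb a * (y2 ^ L - emb r * e) \<in> I" by (rule JI[OF R(3)[OF L]])
      ultimately have "emb a * (y2 ^ L - emb r * e) + e * (emb r * emb a) \<in> I"
        using ideal_type_ringD(2)[OF II] by blast
      then have "y2 ^ L * emb a \<in> I" by (simp add: algebra_simps)
      then have "emb a \<in> I" by (rule nonzerodivisor_power[of y2 I, rotated]) (rule nzdI)
      then show "a \<in> {p. emb p \<in> I}" by simp
    qed
    then obtain s t where s: "emb s \<in> I" "s + r * t = 1" by auto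
    then obtain c where c: "emb s - y1 * c \<in> J" unfolding I_def by blast
    have st: "emb s + emb r * emb t = 1" using s(2) emb_1 by (simp flip: emb_add emb_mult)
    have "(emb s - y1 * c) - (y2 - emb r) * emb t \<in> ideal_radical J"
      by (rule N(6)[OF subsetD[OF J_subset_radical c] N(4)[OF r]])
    moreover have "(emb s - y1 * c) - (y2 - emb r) * emb t = (emb s + emb r * emb t) - (y1 * c + y2 * emb t)"
      by (simp add: algebra_simps)
    ultimately have "1 - (y1 * c + y2 * emb t) \<in> ideal_radical J" using st by simp
    from radical_diff_power[OF this] obtain M' d where "1 ^ M' - (y1 * c + y2 * emb t) * d \<in> J" by blast
    then have "1 - (y1 * (c * d) + y2 * (emb t * d)) \<in> J" by (simp add: algebra_simps)
    then show ?thesis by blast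
  qed
qed

lemma regular_sequence_length:
  assumes reg: "regular_sequence (type_ring Quot J) xs"
  shows "length xs \<le> 1"
proof (rule ccontr)
  let ?G = "type_ring Quot J"
  interpret G: cring ?G by (rule ideal.quotient_is_cring[OF ideal_J cring_type_ring])
  assume "\<not> length xs \<le> 1"
  then have len: "0 < length xs" "1 < length xs" by auto
  have xs: "set xs \<subseteq> carrier ?G" and proper: "Idl\<^bsub>?G\<^esub> (set xs) \<noteq> carrier ?G"
    and nzd: "\<And>i r. i < length xs \<Longrightarrow> r \<in> carrier ?G \<Longrightarrow>
        xs ! i \<otimes>\<^bsub>?G\<^esub> r \<in> Idl\<^bsub>?G\<^esub> (set (take i xs)) \<Longrightarrow> r \<in> Idl\<^bsub>?G\<^esub> (set (take i xs))"
    using reg unfolding regular_sequence_def by blast+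
  have "xs ! 0 \<in> carrier ?G" "xs ! 1 \<in> carrier ?G" using xs len nth_mem by blast+
  then obtain y1 y2 where y: "xs ! 0 = J +>\<^bsub>type_ring\<^esub> y1" "xs ! 1 = J +>\<^bsub>type_ring\<^esub> y2"
    unfolding quot_carrier by blast
  have car: "J +>\<^bsub>type_ring\<^esub> r \<in> carrier ?G" for r by (simp add: quot_carrier)
  have take1: "set (take 1 xs) = {J +>\<^bsub>type_ring\<^esub> y1}"
    using len y(1) by (cases xs) auto
  have 1: "r \<in> J" if "y1 * r \<in> J" for r
    using nzd[OF len(1) car[of r]] that
    unfolding y quot_simps[OF ideal_J] by (simp add: quot_genideal_empty[OF ideal_J])
  have 2: "\<exists>d. r - y1 * d \<in> J" if "y2 * r - y1 * c \<in> J" for r c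
    using nzd[OF len(2) car[of r]] that
    unfolding y quot_simps[OF ideal_J] take1 quot_genideal_single[OF ideal_J] by blast
  have "\<exists>a b. 1 - (y1 * a + y2 * b) \<in> J"
    by (rule regular_pair_generates; (erule 1 | erule 2))
  then obtain a b where ab: "1 - (y1 * a + y2 * b) \<in> J" by blast
  interpret I: ideal "Idl\<^bsub>?G\<^esub> (set xs)" ?G by (rule G.genideal_ideal[OF xs])
  note V = ideal_type_ringD[OF quot_ideal_vimage(1)[OF ideal_J I.is_ideal]]
  have "set xs \<subseteq> Idl\<^bsub>?G\<^esub> (set xs)" by (rule G.genideal_self[OF xs])
  then have "xs ! 0 \<in> Idl\<^bsub>?G\<^esub> (set xs)" "xs ! 1 \<in> Idl\<^bsub>?G\<^esub> (set xs)"
    using len nth_mem by blast+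
  then have "y1 \<in> {f. J +>\<^bsub>type_ring\<^esub> f \<in> Idl\<^bsub>?G\<^esub> (set xs)}" "y2 \<in> {f. J +>\<^bsub>type_ring\<^esub> f \<in> Idl\<^bsub>?G\<^esub> (set xs)}"
    unfolding y by simp_all
  then have "y1 * a + y2 * b \<in> {f. J +>\<^bsub>type_ring\<^esub> f \<in> Idl\<^bsub>?G\<^esub> (set xs)}"
    by (intro V(2) V(4))
  moreover have "1 - (y1 * a + y2 * b) \<in> {f. J +>\<^bsub>type_ring\<^esub> f \<in> Idl\<^bsub>?G\<^esub> (set xs)}"
    using ab quot_ideal_vimage(2)[OF ideal_J I.is_ideal] by blast
  ultimately have "(1 - (y1 * a + y2 * b)) + (y1 * a + y2 * b) \<in> {f. J +>\<^bsub>type_ring\<^esub> f \<in> Idl\<^bsub>?G\<^esub> (set xs)}"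
    using V(2) by blast
  then have "\<one>\<^bsub>?G\<^esub> \<in> Idl\<^bsub>?G\<^esub> (set xs)" unfolding quot_simps[OF ideal_J] by simp
  then show False using proper I.one_imp_carrier by blast
qed

lemma depth_maximal:
  assumes P: "maximalideal P (type_ring Quot J)"
  shows "ideal_depth (type_ring Quot J) P = 1 \<longleftrightarrow>
    (\<exists>y. J +>\<^bsub>type_ring\<^esub> y \<in> P \<and> (\<forall>r. y * r \<in> J \<longrightarrow> r \<in> J))"
proof
  let ?G = "type_ring Quot J"
  interpret G: cring ?G by (rule ideal.quotient_is_cring[OF ideal_J cring_type_ring])
  interpret P: maximalideal P ?G by (rule P)
  have car: "J +>\<^bsub>type_ring\<^esub> r \<in> carrier ?G" for r by (simp add: quot_carrier)
  {
    assume depth: "ideal_depth ?G P = 1"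
    have "\<exists>xs. regular_sequence ?G xs \<and> set xs \<subseteq> P \<and> xs \<noteq> []"
    proof (rule ccontr)
      assume "\<not> ?thesis"
      then have "ideal_depth ?G P \<le> 0"
        unfolding ideal_depth_def by (intro Sup_least) (auto simp: zero_enat_def)
      with depth show False by simp
    qed
    then obtain ys where ys: "regular_sequence ?G ys" "set ys \<subseteq> P" "ys \<noteq> []" by blast
    then obtain x xs where "ys = x # xs" by (cases ys) simp_all
    with ys have reg: "regular_sequence ?G (x # xs)" and xP: "x \<in> P" by simp_all
    then obtain y where y: "x = J +>\<^bsub>type_ring\<^esub> y" using P.a_subset unfolding quot_carrier by blast
    have "r \<in> J" if "y * r \<in> J" for r
    proof -
      have "(x # xs) ! 0 \<otimes>\<^bsub>?G\<^esub> (J +>\<^bsub>type_ring\<^esub> r) \<in> Idl\<^bsub>?G\<^esub> (set (take 0 (x # xs))) \<longrightarrow>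
          J +>\<^bsub>type_ring\<^esub> r \<in> Idl\<^bsub>?G\<^esub> (set (take 0 (x # xs)))"
        using reg car[of r] unfolding regular_sequence_def by blast
      then show ?thesis
        using that by (simp add: y quot_simps[OF ideal_J] quot_genideal_empty[OF ideal_J])
    qed
    with xP y show "\<exists>y. J +>\<^bsub>type_ring\<^esub> y \<in> P \<and> (\<forall>r. y * r \<in> J \<longrightarrow> r \<in> J)" by blast
  next
    assume "\<exists>y. J +>\<^bsub>type_ring\<^esub> y \<in> P \<and> (\<forall>r. y * r \<in> J \<longrightarrow> r \<in> J)"
    then obtain y where y: "J +>\<^bsub>type_ring\<^esub> y \<in> P" "\<And>r. y * r \<in> J \<Longrightarrow> r \<in> J" by blast
    have "Idl\<^bsub>?G\<^esub> {J +>\<^bsub>type_ring\<^esub> y} \<subseteq> P" by (rule G.genideal_minimal[OF P.is_ideal]) (use y in simp)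
    then have "Idl\<^bsub>?G\<^esub> {J +>\<^bsub>type_ring\<^esub> y} \<noteq> carrier ?G"
      using P.I_notcarr P.a_subset by blast
    moreover have "r \<in> Idl\<^bsub>?G\<^esub> {}"
      if r: "r \<in> carrier ?G" "(J +>\<^bsub>type_ring\<^esub> y) \<otimes>\<^bsub>?G\<^esub> r \<in> Idl\<^bsub>?G\<^esub> {}" for r
    proof -
      obtain f where f: "r = J +>\<^bsub>type_ring\<^esub> f" using r(1) unfolding quot_carrier by blast
      show ?thesis
        using r(2) y(2) unfolding f quot_simps[OF ideal_J] quot_genideal_empty[OF ideal_J] by blast
    qed
    ultimately have "regular_sequence ?G [J +>\<^bsub>type_ring\<^esub> y]"
      using car unfolding regular_sequence_def by auto
    then have "\<exists>xs. enat 1 = enat (length xs) \<and> regular_sequence ?G xs \<and> set xs \<subseteq> P"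
      using y(1) by (intro exI[of _ "[J +>\<^bsub>type_ring\<^esub> y]"]) simp
    then have "enat 1 \<le> ideal_depth ?G P"
      unfolding ideal_depth_def by (intro Sup_upper) blast
    moreover have "ideal_depth ?G P \<le> 1"
      unfolding ideal_depth_def one_enat_def
      using regular_sequence_length by (intro Sup_least) auto
    ultimately show "ideal_depth ?G P = 1" by (simp add: one_enat_def)
  }
qed

text \<open>The hypothesis on \<open>E\<close> states, without mentioning linear combinations, that the quotient is generated
by \<open>E\<close> as a module over \<open>K[X]\<close>.\<close>

lemma noetherian_quotient:
  assumes "finite E" and span: "\<And>M. J \<subseteq> M \<Longrightarrow> E \<subseteq> M \<Longrightarrow> (\<And>a b. a \<in> M \<Longrightarrow> b \<in> M \<Longrightarrow> a + b \<in> M) \<Longrightarrow>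
      (\<And>p a. a \<in> M \<Longrightarrow> emb p * a \<in> M) \<Longrightarrow> M = UNIV"
  shows "noetherian_ring (type_ring Quot J)"
proof -
  let ?G = "type_ring Quot J"
  let ?s = "\<lambda>p a. emb p * a"
  interpret G: cring ?G by (rule ideal.quotient_is_cring[OF ideal_J cring_type_ring])
  interpret S: Modules.module ?s
    by unfold_locales (simp_all add: emb_add emb_mult emb_1 algebra_simps)
  have sub: "S.subspace I" if "ideal I type_ring" for I
    using ideal_type_ringD[OF that] by (auto simp: S.subspace_def)
  have full: "S.span (E \<union> J) = UNIV"
    by (rule span) (use S.span_superset S.span_add S.span_scale in blast)+
  show ?thesis
  proof (rule G.noetherian_ringI)
    fix I assume I: "ideal I ?G"
    let ?V = "{f. J +>\<^bsub>type_ring\<^esub> f \<in> I}"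
    note V = quot_ideal_vimage[OF ideal_J I]
    obtain T where T: "finite T" "T \<subseteq> ?V" "?V \<subseteq> S.span (T \<union> J)"
      using finitely_generated_submodule[OF S.module_axioms \<open>finite E\<close> sub[OF ideal_J] sub[OF V(1)] V(2)] full
      by auto
    define A where "A = (+>\<^bsub>type_ring\<^esub>) J ` T"
    have Ac: "A \<subseteq> carrier ?G" by (auto simp: A_def quot_carrier)
    note A = G.genideal_ideal[OF Ac]
    note W = quot_ideal_vimage[OF ideal_J A]
    have "T \<subseteq> {f. J +>\<^bsub>type_ring\<^esub> f \<in> Idl\<^bsub>?G\<^esub> A}"
      using G.genideal_self[OF Ac] by (auto simp: A_def)
    then have "S.span (T \<union> J) \<subseteq> {f. J +>\<^bsub>type_ring\<^esub> f \<in> Idl\<^bsub>?G\<^esub> A}"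
      using W(2) by (intro S.span_minimal sub[OF W(1)]) blast
    moreover have "I \<subseteq> range ((+>\<^bsub>type_ring\<^esub>) J)"
      using additive_subgroup.a_subset[OF ideal.axioms(1)[OF I]] by (simp add: quot_carrier)
    ultimately have "I \<subseteq> Idl\<^bsub>?G\<^esub> A" using T(3) by blast
    moreover have "Idl\<^bsub>?G\<^esub> A \<subseteq> I"
      by (rule G.genideal_minimal[OF I]) (use T(2) in \<open>auto simp: A_def\<close>)
    ultimately show "\<exists>A\<subseteq>carrier ?G. finite A \<and> I = Idl\<^bsub>?G\<^esub> A"
      using Ac T(1) A_def by (intro exI[of _ A]) auto
  qed
qed

text \<open>Codimension and depth are at most \<open>1\<close>, so the Cohen-Macaulay property asks for a nonzerodivisor in
every maximal ideal. At the origin such an element is \<open>X\<close> times a polynomial, up to a nilpotent, and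
so some power of it is a multiple of \<open>X\<close>, which makes \<open>X\<close> itself a nonzerodivisor. Conversely
every maximal ideal contains a nonzero polynomial. The hypothesis \<open>torsion_free\<close> passes from \<open>X\<close> to
such polynomials; it holds for graded rings in which \<open>X\<close> is homogeneous of positive degree.\<close>

lemma cohen_macaulay_iff:
  assumes noeth: "noetherian_ring (type_ring Quot J)"
    and torsion_free: "(\<And>r. emb [:0, 1:] * r \<in> J \<Longrightarrow> r \<in> J) \<Longrightarrow>
      (\<And>p r. p \<noteq> 0 \<Longrightarrow> emb p * r \<in> J \<Longrightarrow> r \<in> J)"
  shows "cohen_macaulay_ring (type_ring Quot J) \<longleftrightarrow> (\<forall>r. emb [:0, 1:] * r \<in> J \<longrightarrow> r \<in> J)"
proof -
  let ?G = "type_ring Quot J"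
  let ?z = "emb [:0, 1:]"
  interpret G: cring ?G by (rule ideal.quotient_is_cring[OF ideal_J cring_type_ring])
  note R = ideal_type_ringD[OF ideal_J]
  note N = ideal_type_ringD[OF radical]
  have CM: "cohen_macaulay_ring ?G \<longleftrightarrow> (\<forall>P. maximalideal P ?G \<longrightarrow>
      (\<exists>y. J +>\<^bsub>type_ring\<^esub> y \<in> P \<and> (\<forall>r. y * r \<in> J \<longrightarrow> r \<in> J)))"
    unfolding cohen_macaulay_ring_def using noeth G.is_cring
    by (simp add: codimension_maximal depth_maximal cong: imp_cong)
  show ?thesis
  proof
    assume cm: "cohen_macaulay_ring ?G"
    \<comment> \<open>\<open>M\<close> is the maximal ideal of the origin \<open>X = 0\<close>.\<close>
    define M where "M = {f. \<exists>p. f - emb ([:0, 1:] * p) \<in> ideal_radical J}"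
    have M: "ideal M type_ring"
      unfolding ideal_type_ring_iff
    proof (intro conjI ballI allI)
      have "0 - emb ([:0, 1:] * 0) \<in> ideal_radical J" using N(1) emb_0 by simp
      then show "0 \<in> M" unfolding M_def by blast
    next
      fix a b assume "a \<in> M" "b \<in> M"
      then obtain c d where "a - emb ([:0, 1:] * c) \<in> ideal_radical J"
        "b - emb ([:0, 1:] * d) \<in> ideal_radical J" unfolding M_def by blast
      then have "(a - emb ([:0, 1:] * c)) + (b - emb ([:0, 1:] * d)) \<in> ideal_radical J"
        by (rule N(2))
      then have "(a + b) - emb ([:0, 1:] * (c + d)) \<in> ideal_radical J"
        unfolding distrib_left emb_add by (simp only: algebra_simps)
      then show "a + b \<in> M" unfolding M_def by blast
    next
      fix f a assume "a \<in> M"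
      then obtain c where c: "a - emb ([:0, 1:] * c) \<in> ideal_radical J" unfolding M_def by blast
      obtain q where q: "f - emb q \<in> ideal_radical J" using reduced by blast
      have "f * (a - emb ([:0, 1:] * c)) + (f - emb q) * emb ([:0, 1:] * c) \<in> ideal_radical J"
        by (intro N(2) N(3)[OF c] N(4)[OF q])
      moreover have "f * (a - emb ([:0, 1:] * c)) + (f - emb q) * emb ([:0, 1:] * c)
          = f * a - emb ([:0, 1:] * (q * c))"
        unfolding emb_mult by (simp only: algebra_simps)
      ultimately have "f * a - emb ([:0, 1:] * (q * c)) \<in> ideal_radical J" by metis
      then show "f * a \<in> M" unfolding M_def by blast
    qed
    have emb_M: "poly p 0 = 0" if p: "emb p \<in> M" for p
    proof -
      obtain q where "emb p - emb ([:0, 1:] * q) \<in> ideal_radical J" using p unfolding M_def by blast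
      then have "p - [:0, 1:] * q = 0" by (intro faithful) (simp only: emb_diff)
      then have "p = [:0, 1:] * q" by simp
      then show ?thesis by simp
    qed
    have NM: "f \<in> M" if "f \<in> ideal_radical J" for f
    proof -
      have "f - emb ([:0, 1:] * 0) \<in> ideal_radical J" using that emb_0 by simp
      then show ?thesis unfolding M_def by blast
    qed
    have "maximalideal M type_ring"
    proof (rule maximalidealI[OF M])
      show "carrier type_ring \<noteq> M" using emb_M[of 1] emb_1 by auto
    next
      fix I assume I: "ideal I type_ring" and MI: "M \<subseteq> I"
      note II = ideal_type_ringD[OF I]
      show "I = M \<or> I = carrier type_ring"
      proof (cases "I = M")
        case False
        with MI obtain f where f: "f \<in> I" "f \<notin> M" by blast
        obtain p where p: "f - emb p \<in> ideal_radical J" using reduced by blast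
        have p0: "poly p 0 \<noteq> 0"
        proof
          assume "poly p 0 = 0"
          then obtain q where "p = [:0, 1:] * q" by (auto simp: poly_eq_0_iff_dvd elim!: dvdE)
          with p f show False unfolding M_def by blast
        qed
        have "f - (f - emb p) \<in> I" by (rule II(6)[OF f(1) subsetD[OF MI NM[OF p]]])
        then have pI: "emb p \<in> I" by simp
        obtain q where q: "p = [:poly p 0:] + [:0, 1:] * q"
          by (cases p) auto
        have "emb ([:0, 1:] * q) - emb ([:0, 1:] * q) \<in> ideal_radical J" using N(1) by simp
        then have "emb ([:0, 1:] * q) \<in> M" unfolding M_def by blast
        then have "emb p - emb ([:0, 1:] * q) \<in> I" by (rule II(6)[OF pI subsetD[OF MI]])
        moreover have "[:poly p 0:] = p - [:0, 1:] * q" using q by (metis add_diff_cancel_right')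
        ultimately have "emb [:poly p 0:] \<in> I" by (simp only: emb_diff)
        then have "emb [:inverse (poly p 0):] * emb [:poly p 0:] \<in> I" by (rule II(3))
        moreover have "[:inverse (poly p 0):] * [:poly p 0:] = 1" using p0 by (simp add: one_pCons)
        ultimately have "1 \<in> I" using emb_1 by (metis emb_mult)
        then have "r \<in> I" for r using II(3)[of 1 r] by simp
        then show ?thesis by auto
      qed simp
    qed
    then have "maximalideal ((+>\<^bsub>type_ring\<^esub>) J ` M) ?G"
      using quot_maximalideal_image[OF ideal_J] NM J_subset_radical by blast
    then obtain y where y: "J +>\<^bsub>type_ring\<^esub> y \<in> (+>\<^bsub>type_ring\<^esub>) J ` M"
      and nzd: "\<And>r. y * r \<in> J \<Longrightarrow> r \<in> J" using cm unfolding CM by blast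
    have "y \<in> M" using y quot_ideal_image(2)[OF ideal_J M] NM J_subset_radical by blast
    then obtain q where "y - emb ([:0, 1:] * q) \<in> ideal_radical J" unfolding M_def by blast
    from radical_diff_power[OF this] obtain L c where L: "y ^ L - emb ([:0, 1:] * q) * c \<in> J" by blast
    show "\<forall>r. ?z * r \<in> J \<longrightarrow> r \<in> J"
    proof (intro allI impI)
      fix r assume r: "?z * r \<in> J"
      have "(y ^ L - emb ([:0, 1:] * q) * c) * r + (emb q * c) * (?z * r) \<in> J"
        by (intro R(2) R(4)[OF L] R(3)[OF r])
      moreover have "(y ^ L - emb ([:0, 1:] * q) * c) * r + (emb q * c) * (?z * r) = y ^ L * r"
        unfolding emb_mult by (simp add: algebra_simps)
      ultimately have "y ^ L * r \<in> J" by metis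
      then show "r \<in> J" by (rule nonzerodivisor_power[of y J, rotated]) (rule nzd)
    qed
  next
    assume nzd: "\<forall>r. ?z * r \<in> J \<longrightarrow> r \<in> J"
    show "cohen_macaulay_ring ?G"
      unfolding CM
    proof (intro allI impI)
      fix P assume P: "maximalideal P ?G"
      let ?V = "{f. J +>\<^bsub>type_ring\<^esub> f \<in> P}"
      have "ideal P ?G" using P unfolding maximalideal_def by simp
      note V = ideal_type_ringD[OF quot_ideal_vimage(1)[OF ideal_J this]]
      obtain f where f: "f \<in> ?V" "f \<notin> ideal_radical J" using radical_psubset_maximal[OF P] by blast
      obtain p where p: "f - emb p \<in> ideal_radical J" using reduced by blast
      have "p \<noteq> 0" using p f(2) emb_0 by auto
      have "f - emb p \<in> ?V" using p radical_psubset_maximal[OF P] by blast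
      then have "f - (f - emb p) \<in> ?V" by (rule V(6)[OF f(1)])
      then have "J +>\<^bsub>type_ring\<^esub> emb p \<in> P" by simp
      then show "\<exists>y. J +>\<^bsub>type_ring\<^esub> y \<in> P \<and> (\<forall>r. y * r \<in> J \<longrightarrow> r \<in> J)"
        using torsion_free \<open>p \<noteq> 0\<close> nzd by blast
    qed
  qed
qed

end

section \<open>Sums of coefficients and the ideal of a monomial curve\<close>

lemma four_distinct [simp]:
  "(1::4) \<noteq> 2" "(1::4) \<noteq> 3" "(1::4) \<noteq> 4" "(2::4) \<noteq> 3" "(2::4) \<noteq> 4" "(3::4) \<noteq> 4"
  "(2::4) \<noteq> 1" "(3::4) \<noteq> 1" "(4::4) \<noteq> 1" "(3::4) \<noteq> 2" "(4::4) \<noteq> 2" "(4::4) \<noteq> 3"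
  by simp_all

lemma UNIV_four: "(UNIV :: 4 set) = {1, 2, 3, 4}"
proof -
  have "card {1, 2, 3, 4 :: 4} = card (UNIV :: 4 set)" by simp
  then show ?thesis using card_subset_eq[of "UNIV :: 4 set" "{1, 2, 3, 4}"] by simp
qed

lemma four_cases: "i = 1 \<or> i = 2 \<or> i = 3 \<or> i = (4::4)"
  using UNIV_four by (metis UNIV_I empty_iff insert_iff)

text \<open>Membership in the curve ideal and in its tangent ideal is the vanishing of such functionals for
suitable predicates \<open>Q\<close>, and multiplying by a monomial just translates \<open>Q\<close>.\<close>

definition coeff_sum :: "(expo4 \<Rightarrow> bool) \<Rightarrow> 'k::field poly4 \<Rightarrow> 'k" where
  "coeff_sum Q f = (\<Sum>u\<in>{u \<in> Poly_Mapping.keys f. Q u}. Poly_Mapping.lookup f u)"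

lemma coeff_sum_superset:
  assumes "finite A" "Poly_Mapping.keys f \<subseteq> A"
  shows "coeff_sum Q f = (\<Sum>u\<in>{u \<in> A. Q u}. Poly_Mapping.lookup f u)"
  unfolding coeff_sum_def
  by (rule sum.mono_neutral_left) (use assms in \<open>auto simp: in_keys_iff\<close>)

lemma coeff_sum_0 [simp]: "coeff_sum Q 0 = 0"
  by (simp add: coeff_sum_def)

lemma coeff_sum_add: "coeff_sum Q (f + g) = coeff_sum Q f + coeff_sum Q g"
proof -
  let ?A = "Poly_Mapping.keys f \<union> Poly_Mapping.keys g"
  have "coeff_sum Q (f + g) = (\<Sum>u\<in>{u \<in> ?A. Q u}. Poly_Mapping.lookup (f + g) u)"
    by (rule coeff_sum_superset) (simp_all add: keys_add)
  moreover have "coeff_sum Q f = (\<Sum>u\<in>{u \<in> ?A. Q u}. Poly_Mapping.lookup f u)"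
    by (rule coeff_sum_superset) auto
  moreover have "coeff_sum Q g = (\<Sum>u\<in>{u \<in> ?A. Q u}. Poly_Mapping.lookup g u)"
    by (rule coeff_sum_superset) auto
  ultimately show ?thesis by (simp add: lookup_add sum.distrib)
qed

lemma coeff_sum_diff: "coeff_sum Q (f - g) = coeff_sum Q f - coeff_sum Q g"
  using coeff_sum_add[of Q "f - g" g] by simp

lemma coeff_sum_single: "coeff_sum Q (Poly_Mapping.single u c) = (if Q u then c else 0)"
proof -
  have "coeff_sum Q (Poly_Mapping.single u c) = (\<Sum>v\<in>{v \<in> {u}. Q v}. Poly_Mapping.lookup (Poly_Mapping.single u c) v)"
    by (rule coeff_sum_superset) auto
  also have "{v \<in> {u}. Q v} = (if Q u then {u} else {})" by auto
  finally show ?thesis by simp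
qed

lemma coeff_sum_cong: "(\<And>u. u \<in> Poly_Mapping.keys f \<Longrightarrow> Q u = Q' u) \<Longrightarrow> coeff_sum Q f = coeff_sum Q' f"
  unfolding coeff_sum_def by (rule sum.cong) auto

lemma coeff_sum_eq: "coeff_sum (\<lambda>v. v = u) f = Poly_Mapping.lookup f u"
proof -
  have "coeff_sum (\<lambda>v. v = u) f = (\<Sum>v\<in>{v \<in> insert u (Poly_Mapping.keys f). v = u}. Poly_Mapping.lookup f v)"
    by (rule coeff_sum_superset) auto
  also have "{v \<in> insert u (Poly_Mapping.keys f). v = u} = {u}" by auto
  finally show ?thesis by simp
qed

lemma poly4_induct [case_names single add]:
  assumes single: "\<And>u c. P (Poly_Mapping.single u c)"
    and add: "\<And>f g. P f \<Longrightarrow> P g \<Longrightarrow> P (f + g)"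
  shows "P (f :: 'k::field poly4)"
proof -
  have "P (\<Sum>u\<in>A. Poly_Mapping.single u (Poly_Mapping.lookup f u))" if "finite A" for A
    using that
  proof induction
    case empty
    then show ?case using single[of 0 0] by simp
  qed (simp add: single add)
  moreover have "f = (\<Sum>u\<in>Poly_Mapping.keys f. Poly_Mapping.single u (Poly_Mapping.lookup f u))"
    by (rule poly_mapping_eqI)
      (simp add: lookup_sum lookup_single when_def sum.delta' in_keys_iff)
  ultimately show ?thesis by (metis finite_keys)
qed

lemma coeff_sum_single_mult:
  "coeff_sum Q (Poly_Mapping.single w c * f) = c * coeff_sum (\<lambda>u. Q (w + u)) f"
  by (induction f rule: poly4_induct)
    (simp_all add: mult_single coeff_sum_single distrib_left coeff_sum_add)

lemma lookup_single_mult: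
  "Poly_Mapping.lookup (Poly_Mapping.single w c * f) (w + u) = c * Poly_Mapping.lookup (f :: 'k::field poly4) u"
  by (simp flip: coeff_sum_eq add: coeff_sum_single_mult)

definition weight :: "(4 \<Rightarrow> nat) \<Rightarrow> expo4 \<Rightarrow> nat" where
  "weight n u = (\<Sum>i\<in>UNIV. Poly_Mapping.lookup u i * n i)"

lemma weight_add [simp]: "weight n (u + v) = weight n u + weight n v"
  by (simp add: weight_def lookup_add algebra_simps sum.distrib)

lemma weight_0 [simp]: "weight n 0 = 0"
  by (simp add: weight_def)

lemma weight_single [simp]: "weight n (Poly_Mapping.single i k) = k * n i"
  by (simp add: weight_def lookup_single when_def if_distrib[of "\<lambda>a. a * _"] cong: if_cong)

lemma expo_deg_add [simp]: "expo_deg (u + v) = expo_deg u + expo_deg v"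
  by (simp add: expo_deg_def lookup_add sum.distrib)

lemma expo_deg_single [simp]: "expo_deg (Poly_Mapping.single i k) = k"
  by (simp add: expo_deg_def lookup_single when_def)

lemma curve_ideal_iff:
  "f \<in> curve_ideal n \<longleftrightarrow> (\<forall>s. coeff_sum (\<lambda>u. weight n u = s) (f :: 'k::field poly4) = 0)"
proof -
  have m: "(\<Prod>i\<in>UNIV. Polynomial.monom 1 (n i) ^ Poly_Mapping.lookup u i) = Polynomial.monom (1::'k) (weight n u)" for u
    unfolding weight_def UNIV_four
    by (simp only: monom_power power_one mult.commute[of _ "n _"]) (simp add: mult_monom)
  have "coeff (curve_hom n f) s = (\<Sum>u\<in>Poly_Mapping.keys f. if weight n u = s then Poly_Mapping.lookup f u else 0)" for s
    unfolding curve_hom_def m Polynomial.coeff_sum by (rule sum.cong) auto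
  then have "coeff (curve_hom n f) s = coeff_sum (\<lambda>u. weight n u = s) f" for s
    unfolding coeff_sum_def by (simp add: sum.inter_filter)
  then show ?thesis unfolding curve_ideal_def by (auto simp: poly_eq_iff)
qed

lemma binomial_in_curve_ideal:
  "xmonomial u - xmonomial v \<in> (curve_ideal n :: 'k::field poly4 set) \<longleftrightarrow> weight n u = weight n v"
  by (auto simp: curve_ideal_iff coeff_sum_diff xmonomial_def coeff_sum_single split: if_splits)

section \<open>Monomials of top degree in their fibre\<close>

definition top_degree :: "(4 \<Rightarrow> nat) \<Rightarrow> expo4 \<Rightarrow> bool" where
  "top_degree n u \<longleftrightarrow> (\<forall>v. weight n v = weight n u \<longrightarrow> expo_deg v \<le> expo_deg u)"

definition top_sum :: "(4 \<Rightarrow> nat) \<Rightarrow> nat \<Rightarrow> 'k::field poly4 \<Rightarrow> 'k" where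
  "top_sum n s = coeff_sum (\<lambda>u. weight n u = s \<and> top_degree n u)"

lemma top_degree_addD: "top_degree n (w + u) \<Longrightarrow> top_degree n u"
  unfolding top_degree_def
proof (intro allI impI)
  fix v assume "\<forall>v. weight n v = weight n (w + u) \<longrightarrow> expo_deg v \<le> expo_deg (w + u)" "weight n v = weight n u"
  then show "expo_deg v \<le> expo_deg u" by (auto dest: spec[of _ "w + v"])
qed

lemma top_degree_cong:
  "top_degree n u \<Longrightarrow> weight n v = weight n u \<Longrightarrow> expo_deg v = expo_deg u \<Longrightarrow> top_degree n v"
  unfolding top_degree_def by simp

lemma top_degree_deg_eq:
  "top_degree n u \<Longrightarrow> top_degree n v \<Longrightarrow> weight n v = weight n u \<Longrightarrow> expo_deg v = expo_deg u"
  unfolding top_degree_def by (simp add: le_antisym)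

text \<open>Multiplication by a monomial \<open>x\<^sup>w\<close> acts on the functionals as a shift or kills them: if some
\<open>x\<^sup>w x\<^sup>u\<close> is of top degree, then the monomials of top degree in the fibre of \<open>x\<^sup>u\<close> are exactly those
that \<open>x\<^sup>w\<close> carries to monomials of top degree. This is the multiplication rule of the associated
graded ring of the semigroup ring for the order filtration.\<close>

lemma top_sum_single_mult:
  "top_sum n s (Poly_Mapping.single w c * f) =
    (if \<exists>u. weight n (w + u) = s \<and> top_degree n (w + u) then c * top_sum n (s - weight n w) f else 0)"
proof (cases "\<exists>u. weight n (w + u) = s \<and> top_degree n (w + u)")
  case True
  then obtain u0 where u0: "weight n (w + u0) = s" "top_degree n (w + u0)" by blast
  have "(weight n (w + u) = s \<and> top_degree n (w + u)) = (weight n u = s - weight n w \<and> top_degree n u)" for u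
  proof
    assume "weight n (w + u) = s \<and> top_degree n (w + u)"
    then show "weight n u = s - weight n w \<and> top_degree n u" using top_degree_addD by auto
  next
    assume u: "weight n u = s - weight n w \<and> top_degree n u"
    have "weight n u = weight n u0" using u u0 by auto
    then have "expo_deg u = expo_deg u0"
      using u u0 top_degree_deg_eq[OF top_degree_addD[OF u0(2)]] by blast
    then show "weight n (w + u) = s \<and> top_degree n (w + u)"
      using u u0 \<open>weight n u = weight n u0\<close> top_degree_cong[OF u0(2)] by simp
  qed
  then show ?thesis using True by (simp add: top_sum_def coeff_sum_single_mult)
next
  case False
  then have "\<not> (weight n (w + u) = s \<and> top_degree n (w + u))" for u by blast
  then have "coeff_sum (\<lambda>u. weight n (w + u) = s \<and> top_degree n (w + u)) f = 0"
    unfolding coeff_sum_def by (intro sum.neutral) blast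
  then show ?thesis using False by (simp only: top_sum_def coeff_sum_single_mult if_False mult_zero_right)
qed

lemma top_sum_add: "top_sum n s (f + g) = top_sum n s f + top_sum n s g"
  by (simp add: top_sum_def coeff_sum_add)

lemma top_sum_mult_eq_0:
  assumes "\<And>t. t \<le> s \<Longrightarrow> top_sum n t f = 0"
  shows "top_sum n s (r * f) = 0"
proof (induction r rule: poly4_induct)
  case (single w c)
  then show ?case by (simp add: top_sum_single_mult assms)
qed (simp add: distrib_right top_sum_add)

text \<open>A description of the tangent ideal by linear equations.\<close>

definition top_kernel :: "(4 \<Rightarrow> nat) \<Rightarrow> 'k::field poly4 set" where
  "top_kernel n = {f. \<forall>s. top_sum n s f = 0}"

lemma ideal_top_kernel: "ideal (top_kernel n :: 'k::field poly4 set) type_ring"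
  unfolding ideal_type_ring_iff top_kernel_def
  by (auto simp: top_sum_add top_sum_mult_eq_0) (simp add: top_sum_def)

lemma single_in_top_kernel:
  "c \<noteq> 0 \<Longrightarrow> Poly_Mapping.single u c \<in> top_kernel n \<longleftrightarrow> \<not> top_degree n u"
  by (auto simp: top_kernel_def top_sum_def coeff_sum_single)

lemma least_form_binomial:
  "expo_deg u < expo_deg v \<Longrightarrow> least_form (xmonomial u - xmonomial v :: 'k::field poly4) = xmonomial u"
  "u \<noteq> v \<Longrightarrow> expo_deg u = expo_deg v \<Longrightarrow> least_form (xmonomial u - xmonomial v :: 'k poly4) = xmonomial u - xmonomial v"
proof -
  have k: "Poly_Mapping.keys (xmonomial u - xmonomial v :: 'k poly4) = {u, v}" if "u \<noteq> v"
    using that by (auto simp: in_keys_iff xmonomial_def lookup_minus lookup_single when_def split: if_splits)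
  {
    assume lt: "expo_deg u < expo_deg v"
    then have uv: "u \<noteq> v" by auto
    have "Min {expo_deg u, expo_deg v} = expo_deg u" using lt by simp
    then have "{w \<in> {u, v}. expo_deg w = Min (expo_deg ` {u, v})} = {u}" using lt by auto
    then show "least_form (xmonomial u - xmonomial v :: 'k poly4) = xmonomial u"
      unfolding least_form_def k[OF uv] using uv
      by (simp add: xmonomial_def lookup_minus lookup_single)
  next
    assume uv: "u \<noteq> v" and eq: "expo_deg u = expo_deg v"
    have "{w \<in> {u, v}. expo_deg w = Min (expo_deg ` {u, v})} = {u, v}" using eq by auto
    then show "least_form (xmonomial u - xmonomial v :: 'k poly4) = xmonomial u - xmonomial v"
      unfolding least_form_def k[OF uv] using uv
      by (simp add: xmonomial_def lookup_minus lookup_single single_uminus)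
  }
qed

section \<open>The tangent ideal\<close>

locale monomial_curve =
  fixes n :: "4 \<Rightarrow> nat"
  assumes pos: "0 < n i" and first_least: "i \<noteq> 1 \<Longrightarrow> n 1 < n i"
begin

lemma expo_deg_le_weight: "expo_deg u \<le> weight n u"
  unfolding expo_deg_def weight_def
  by (rule sum_mono) (use pos in \<open>simp add: Suc_leI\<close>)

lemma ex_top_degree: "\<exists>v. weight n v = weight n u \<and> top_degree n v \<and> expo_deg u \<le> expo_deg v"
proof -
  have "\<forall>v. weight n v = weight n u \<longrightarrow> expo_deg v < Suc (weight n u)"
    using expo_deg_le_weight by (metis less_Suc_eq_le)
  from ex_has_greatest_nat[of "\<lambda>v. weight n v = weight n u", OF refl this]
  obtain v where "weight n v = weight n u" "\<forall>w. weight n w = weight n u \<longrightarrow> expo_deg w \<le> expo_deg v"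
    by auto
  then show ?thesis unfolding top_degree_def by (metis (full_types))
qed

text \<open>If a term of \<open>least_form f\<close> is of top degree, then all terms of \<open>f\<close> in its fibre have the same degree,
since their degrees are bounded below by the least degree and above by the top degree. The sum of
their coefficients vanishes because \<open>f\<close> is in the curve ideal.\<close>

lemma least_form_in_top_kernel:
  assumes f: "f \<in> curve_ideal n"
  shows "least_form f \<in> (top_kernel n :: 'k::field poly4 set)"
  unfolding top_kernel_def
proof (intro CollectI allI)
  fix s
  let ?d = "Min (expo_deg ` Poly_Mapping.keys f)"
  let ?A = "{u \<in> Poly_Mapping.keys f. expo_deg u = ?d}"
  have lf: "Poly_Mapping.lookup (least_form f) u = (if u \<in> ?A then Poly_Mapping.lookup f u else 0)" for u
    unfolding least_form_def
    by (simp add: lookup_sum lookup_single when_def sum.delta' del: mem_Collect_eq)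
  have sub: "Poly_Mapping.keys (least_form f) \<subseteq> Poly_Mapping.keys f"
    by (auto simp: in_keys_iff lf split: if_splits)
  have eq: "top_sum n s (least_form f) =
      (\<Sum>u\<in>{u \<in> Poly_Mapping.keys f. weight n u = s \<and> top_degree n u}. Poly_Mapping.lookup (least_form f) u)"
    unfolding top_sum_def by (rule coeff_sum_superset) (use sub in simp_all)
  show "top_sum n s (least_form f) = 0"
  proof (cases "\<exists>u\<in>?A. weight n u = s \<and> top_degree n u")
    case False
    then show ?thesis unfolding eq by (intro sum.neutral) (auto simp: lf)
  next
    case True
    then obtain u where u: "u \<in> Poly_Mapping.keys f" "expo_deg u = ?d" "weight n u = s" "top_degree n u"
      by blast
    have "v \<in> ?A \<and> top_degree n v" if v: "v \<in> Poly_Mapping.keys f" "weight n v = s" for v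
    proof -
      have "?d \<le> expo_deg v" using v(1) by simp
      moreover have "expo_deg v \<le> expo_deg u" using u v unfolding top_degree_def by auto
      ultimately have "expo_deg v = expo_deg u" using u(2) by simp
      then show ?thesis using u v top_degree_cong[OF u(4)] by simp
    qed
    then have "top_sum n s (least_form f) = (\<Sum>u\<in>{u \<in> Poly_Mapping.keys f. weight n u = s}. Poly_Mapping.lookup f u)"
      unfolding eq by (intro sum.cong) (auto simp: lf)
    also have "\<dots> = 0" using f unfolding curve_ideal_iff coeff_sum_def by blast
    finally show ?thesis .
  qed
qed

text \<open>The tangent ideal contains each monomial that is not of top degree, as the least form of a binomial
\<open>x\<^sup>u - x\<^sup>v\<close>, and each homogeneous binomial of the curve ideal. These suffice to eliminate the terms of
an element of the kernel one at a time: a term of top degree can be moved to another one in the same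
fibre, which exists because the coefficients there add up to zero.\<close>

lemma tangent_ideal_curve_ideal:
  "tangent_ideal (curve_ideal n :: 'k::field poly4 set) = top_kernel n"
proof
  interpret R: cring "type_ring :: 'k poly4 ring" by (rule cring_type_ring)
  let ?T = "tangent_ideal (curve_ideal n :: 'k poly4 set)"
  show sub: "?T \<subseteq> top_kernel n"
    unfolding tangent_ideal_def
    by (rule R.genideal_minimal[OF ideal_top_kernel]) (auto intro: least_form_in_top_kernel)
  have idT: "ideal ?T type_ring"
    unfolding tangent_ideal_def by (rule R.genideal_ideal) simp
  note T = ideal_type_ringD[OF idT]
  note K = ideal_type_ringD[OF ideal_top_kernel[of n]]
  have lf: "least_form f \<in> ?T" if "f \<in> curve_ideal n" for f
    unfolding tangent_ideal_def using R.genideal_self[of "least_form ` curve_ideal n"] that by auto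
  have mono: "xmonomial u \<in> ?T" if u: "\<not> top_degree n u" for u
  proof -
    obtain v where v: "weight n v = weight n u" "expo_deg u < expo_deg v"
      using u unfolding top_degree_def by (auto simp: not_le)
    have "least_form (xmonomial u - xmonomial v :: 'k poly4) \<in> ?T"
      by (rule lf) (simp add: binomial_in_curve_ideal v)
    then show ?thesis by (simp add: least_form_binomial(1)[OF v(2)])
  qed
  have binom: "xmonomial u - xmonomial v \<in> ?T"
    if uv: "weight n u = weight n v" "expo_deg u = expo_deg v" for u v
  proof (cases "u = v")
    case False
    have "least_form (xmonomial u - xmonomial v :: 'k poly4) \<in> ?T"
      by (rule lf) (simp add: binomial_in_curve_ideal uv)
    then show ?thesis by (simp add: least_form_binomial(2)[OF False uv(2)])
  qed (use T(1) in simp)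
  have scale: "Poly_Mapping.single u c = Poly_Mapping.single 0 c * (xmonomial u :: 'k poly4)" for u c
    by (simp add: xmonomial_def mult_single)
  have "f \<in> ?T" if "f \<in> top_kernel n" for f
    using that
  proof (induction "card (Poly_Mapping.keys f)" arbitrary: f rule: less_induct)
    case less
    show ?case
    proof (cases "f = 0")
      case True
      then show ?thesis using T(1) by simp
    next
      case False
      then obtain u where u: "u \<in> Poly_Mapping.keys f" 
        using poly_mapping_eqI[of f 0] by (auto simp: in_keys_iff)
      define c where "c = Poly_Mapping.lookup f u"
      have "\<exists>g\<in>?T. Poly_Mapping.keys (f - g) \<subseteq> Poly_Mapping.keys f - {u}"
      proof (cases "top_degree n u")
        case False
        have "Poly_Mapping.single u c \<in> ?T"
          by (subst scale) (rule T(3)[OF mono[OF False]])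
        moreover have "Poly_Mapping.keys (f - Poly_Mapping.single u c) \<subseteq> Poly_Mapping.keys f - {u}"
          by (auto simp: in_keys_iff lookup_minus lookup_single when_def c_def split: if_splits)
        ultimately show ?thesis by blast
      next
        case top: True
        have "\<exists>v \<in> Poly_Mapping.keys f. v \<noteq> u \<and> weight n v = weight n u \<and> top_degree n v"
        proof (rule ccontr)
          assume "\<not> ?thesis"
          then have "{v \<in> Poly_Mapping.keys f. weight n v = weight n u \<and> top_degree n v} = {u}"
            using u top by auto
          then have "top_sum n (weight n u) f = c" by (simp add: top_sum_def coeff_sum_def c_def)
          moreover have "top_sum n (weight n u) f = 0" using less.prems by (simp add: top_kernel_def)
          ultimately show False using u by (simp add: c_def in_keys_iff)
        qed
        then obtain v where v: "v \<in> Poly_Mapping.keys f" "v \<noteq> u" "weight n v = weight n u" "top_degree n v"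
          by blast
        have "Poly_Mapping.single 0 c * (xmonomial u - xmonomial v) \<in> ?T"
          by (rule T(3)[OF binom[OF v(3)[symmetric] top_degree_deg_eq[OF v(4) top v(3)[symmetric]]]])
        moreover have "Poly_Mapping.single 0 c * (xmonomial u - xmonomial v) =
            Poly_Mapping.single u c - Poly_Mapping.single v c"
          by (simp add: right_diff_distrib xmonomial_def mult_single)
        moreover have "Poly_Mapping.keys (f - (Poly_Mapping.single u c - Poly_Mapping.single v c)) \<subseteq> Poly_Mapping.keys f - {u}"
          using v(1,2) by (auto simp: in_keys_iff lookup_minus lookup_single when_def c_def split: if_splits)
        ultimately show ?thesis by metis
      qed
      then obtain g where g: "g \<in> ?T" "Poly_Mapping.keys (f - g) \<subseteq> Poly_Mapping.keys f - {u}" by blast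
      have "card (Poly_Mapping.keys (f - g)) \<le> card (Poly_Mapping.keys f - {u})"
        using g(2) by (intro card_mono) auto
      also have "\<dots> < card (Poly_Mapping.keys f)" using u by (intro card_Diff1_less) auto
      finally have "f - g \<in> ?T"
        using less.hyps K(6)[OF less.prems subsetD[OF sub g(1)]] by blast
      then have "(f - g) + g \<in> ?T" using g(1) by (rule T(2))
      then show ?thesis by simp
    qed
  qed
  then show "top_kernel n \<subseteq> ?T" by blast
qed

end

section \<open>The tangent cone as a thickening of the first coordinate axis\<close>

text \<open>The inclusion of \<open>K[x\<^sub>1]\<close> into \<open>K[x\<^sub>1,\<dots>,x\<^sub>4]\<close>.\<close>

definition axis_poly :: "'k::field poly \<Rightarrow> 'k poly4" where
  "axis_poly p = poly (map_poly (Poly_Mapping.single 0) p) (xvar 1)"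

lemma axis_poly_0 [simp]: "axis_poly 0 = 0"
  by (simp add: axis_poly_def)

lemma axis_poly_pCons: "axis_poly (pCons a p) = Poly_Mapping.single 0 a + xvar 1 * axis_poly p"
  by (simp add: axis_poly_def map_poly_pCons)

lemma axis_poly_X: "axis_poly [:0, 1:] = xvar 1"
  by (simp add: axis_poly_pCons)

lemma axis_poly_1: "axis_poly 1 = 1"
  by (simp add: one_pCons axis_poly_pCons)

lemma axis_poly_add: "axis_poly (p + q) = axis_poly p + axis_poly q"
  by (induction p q rule: poly_induct2) (simp_all add: axis_poly_pCons single_add algebra_simps)

lemma axis_poly_smult: "axis_poly (Polynomial.smult c p) = Poly_Mapping.single 0 c * axis_poly p"
  by (induction p) (simp_all add: axis_poly_pCons mult_single algebra_simps)

lemma axis_poly_mult: "axis_poly (p * q) = axis_poly p * axis_poly q"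
  by (induction p) (simp_all add: axis_poly_pCons axis_poly_add axis_poly_smult algebra_simps)

lemma axis_poly_power: "axis_poly (p ^ k) = axis_poly p ^ k"
  by (induction k) (simp_all add: axis_poly_1 axis_poly_mult)

lemma axis_poly_monom: "axis_poly (Polynomial.monom c k) = Poly_Mapping.single (Poly_Mapping.single 1 k) c"
  by (induction k)
    (simp_all add: monom_0 monom_Suc axis_poly_pCons xvar_def xmonomial_def mult_single flip: single_add)

lemma lookup_axis_poly: "Poly_Mapping.lookup (axis_poly p) (Poly_Mapping.single 1 j) = coeff p j"
proof (induction p arbitrary: j)
  case (pCons a p)
  show ?case
  proof (cases j)
    case 0
    have ne: "Poly_Mapping.single 1 1 + v \<noteq> 0" for v :: expo4
      by (metis add_is_0 lookup_add lookup_single_eq lookup_zero one_neq_zero)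
    have "coeff_sum (\<lambda>v. v = 0) (xvar 1 * axis_poly p) = 0"
      unfolding xvar_def xmonomial_def coeff_sum_single_mult using ne by (simp add: coeff_sum_def)
    then show ?thesis using 0 by (simp add: axis_poly_pCons lookup_add coeff_sum_eq)
  next
    case (Suc i)
    have "(Poly_Mapping.single 1 j :: expo4) = Poly_Mapping.single 1 1 + Poly_Mapping.single 1 i"
      by (simp add: Suc flip: single_add)
    then have "Poly_Mapping.lookup (xvar 1 * axis_poly p) (Poly_Mapping.single 1 j) = coeff p i"
      by (simp only: xvar_def xmonomial_def lookup_single_mult pCons.IH mult_1)
    moreover have "Poly_Mapping.single 1 j \<noteq> (0 :: expo4)"
      using Suc by (metis lookup_single_eq lookup_zero nat.distinct(1))
    ultimately show ?thesis by (simp add: axis_poly_pCons lookup_add lookup_single when_def Suc)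
  qed
qed simp

lemma xvar_power: "xvar i ^ k = Poly_Mapping.single (Poly_Mapping.single i k) (1 :: 'k::field)"
  by (induction k) (simp_all add: xvar_def xmonomial_def mult_single flip: single_add)

lemma expo_split:
  fixes u :: expo4
  assumes "k \<le> Poly_Mapping.lookup u i"
  shows "u = Poly_Mapping.single i k + (u - Poly_Mapping.single i k)"
proof -
  have "Poly_Mapping.single i k + (u - Poly_Mapping.single i k) = u"
    using assms by (intro poly_mapping_eqI) (auto simp: lookup_add lookup_minus lookup_single when_def)
  then show ?thesis by simp
qed

context monomial_curve
begin

lemma xvar_power_in_top_kernel:
  assumes "i \<noteq> 1"
  shows "xvar i ^ n 1 \<in> (top_kernel n :: 'k::field poly4 set)"
proof -
  have "\<not> top_degree n (Poly_Mapping.single i (n 1))"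
    unfolding top_degree_def using first_least[OF assms]
    by (auto intro!: exI[of _ "Poly_Mapping.single 1 (n i)"] simp: mult.commute)
  then show ?thesis unfolding xvar_power by (simp add: single_in_top_kernel)
qed

text \<open>The degree of a monomial is at most its weight divided by \<open>n\<^sub>1\<close>, with equality only for powers
of \<open>x\<^sub>1\<close>. So a power of \<open>x\<^sub>1\<close> is the one monomial of top degree in its fibre.\<close>

lemma top_degree_axis:
  "weight n u = j * n 1 \<and> top_degree n u \<longleftrightarrow> u = Poly_Mapping.single 1 j"
proof
  have weight: "n 1 * expo_deg u \<le> weight n u" for u
    unfolding expo_deg_def weight_def sum_distrib_left
    by (rule sum_mono) (use first_least in \<open>metis less_imp_le mult.commute mult_le_mono1 order_refl\<close>)
  {
    assume u: "weight n u = j * n 1 \<and> top_degree n u"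
    then have "j \<le> expo_deg u" unfolding top_degree_def
      by (auto dest: spec[of _ "Poly_Mapping.single 1 j"])
    then have "weight n u \<le> n 1 * expo_deg u" using u by (simp add: mult.commute)
    then have le: "(\<Sum>i\<in>UNIV. Poly_Mapping.lookup u i * n i) \<le> (\<Sum>i\<in>UNIV. n 1 * Poly_Mapping.lookup u i)"
      by (simp add: weight_def expo_deg_def sum_distrib_left)
    have zero: "Poly_Mapping.lookup u i = 0" if i: "i \<noteq> 1" for i
    proof (rule ccontr)
      assume "Poly_Mapping.lookup u i \<noteq> 0"
      then have "n 1 * Poly_Mapping.lookup u i < Poly_Mapping.lookup u i * n i"
        using first_least[OF i] by simp
      moreover have "n 1 * Poly_Mapping.lookup u j \<le> Poly_Mapping.lookup u j * n j" for j
        using first_least[of j] by (cases "j = 1") simp_all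
      ultimately have "(\<Sum>i\<in>UNIV. n 1 * Poly_Mapping.lookup u i) < (\<Sum>i\<in>UNIV. Poly_Mapping.lookup u i * n i)"
        by (intro sum_strict_mono_ex1) auto
      with le show False by simp
    qed
    then have eq: "u = Poly_Mapping.single 1 (Poly_Mapping.lookup u 1)"
      by (intro poly_mapping_eqI) (auto simp: lookup_single when_def)
    then have "weight n u = Poly_Mapping.lookup u 1 * n 1" by (metis weight_single)
    then have "Poly_Mapping.lookup u 1 = j" using u pos[of 1] by simp
    with eq show "u = Poly_Mapping.single 1 j" by simp
  next
    assume u: "u = Poly_Mapping.single 1 j"
    have "expo_deg v \<le> expo_deg u" if "weight n v = weight n u" for v
      using weight[of v] that pos[of 1] unfolding u by simp
    then show "weight n u = j * n 1 \<and> top_degree n u" unfolding top_degree_def using u by simp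
  }
qed

lemma top_sum_axis: "top_sum n (j * n 1) f = Poly_Mapping.lookup f (Poly_Mapping.single 1 j)"
  by (simp add: top_sum_def top_degree_axis coeff_sum_eq)

lemma thickened_line_top_kernel:
  "thickened_line (top_kernel n) (axis_poly :: 'k::field poly \<Rightarrow> 'k poly4)"
proof (rule thickened_line.intro)
  note N = ideal_type_ringD[OF ideal_radical[OF ideal_top_kernel[of n]]]
  fix f :: "'k poly4" and p q :: "'k poly"
  show "ideal (top_kernel n) (type_ring :: 'k poly4 ring)" by (rule ideal_top_kernel)
  show "\<exists>p. f - axis_poly p \<in> ideal_radical (top_kernel n)"
  proof (induction f rule: poly4_induct)
    case (single u c)
    show ?case
    proof (cases "\<exists>i. i \<noteq> 1 \<and> 0 < Poly_Mapping.lookup u i")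
      case False
      then have "u = Poly_Mapping.single 1 (Poly_Mapping.lookup u 1)"
        by (intro poly_mapping_eqI) (auto simp: lookup_single when_def)
      then have "Poly_Mapping.single u c = axis_poly (Polynomial.monom c (Poly_Mapping.lookup u 1))"
        by (metis axis_poly_monom)
      then show ?thesis using N(1) by (metis diff_self)
    next
      case True
      then obtain i where i: "i \<noteq> 1" "1 \<le> Poly_Mapping.lookup u i" by (auto simp: Suc_le_eq)
      have "xvar i \<in> (ideal_radical (top_kernel n) :: 'k poly4 set)"
        using xvar_power_in_top_kernel[OF i(1)] unfolding ideal_radical_def by blast
      then have "xvar i * Poly_Mapping.single (u - Poly_Mapping.single i 1) c \<in> ideal_radical (top_kernel n)"
        by (rule N(4))
      moreover have "xvar i * Poly_Mapping.single (u - Poly_Mapping.single i 1) c = Poly_Mapping.single u c"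
        using expo_split[OF i(2)] by (simp add: xvar_def xmonomial_def mult_single)
      ultimately show ?thesis by (intro exI[of _ 0]) simp
    qed
  next
    case (add f g)
    then obtain p q where "f - axis_poly p \<in> ideal_radical (top_kernel n)" "g - axis_poly q \<in> ideal_radical (top_kernel n)"
      by blast
    then have "(f - axis_poly p) + (g - axis_poly q) \<in> ideal_radical (top_kernel n)" by (rule N(2))
    then show ?case by (intro exI[of _ "p + q"]) (simp add: axis_poly_add algebra_simps)
  qed
  show "p = 0" if p: "(axis_poly p :: 'k poly4) \<in> ideal_radical (top_kernel n)"
  proof -
    obtain k where "axis_poly p ^ k \<in> (top_kernel n :: 'k poly4 set)"
      using p unfolding ideal_radical_def by blast
    then have "top_sum n (j * n 1) (axis_poly (p ^ k)) = 0" for j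
      unfolding axis_poly_power top_kernel_def by blast
    then have "coeff (p ^ k) j = 0" for j by (simp add: top_sum_axis lookup_axis_poly)
    then have "p ^ k = 0" by (simp add: poly_eq_iff)
    then show ?thesis by simp
  qed
qed (simp_all add: axis_poly_add axis_poly_mult axis_poly_1)

text \<open>The monomials with small exponents generate the tangent cone as a \<open>K[x\<^sub>1]\<close>-module, since powers of
\<open>x\<^sub>1\<close> can be split off and \<open>x\<^sub>i^n\<^sub>1\<close> vanishes for \<open>i \<noteq> 1\<close>.\<close>

lemma noetherian_tangent_cone:
  "noetherian_ring ((type_ring :: 'k::field poly4 ring) Quot top_kernel n)"
proof -
  interpret thickened_line "top_kernel n" "axis_poly :: 'k poly \<Rightarrow> 'k poly4"
    by (rule thickened_line_top_kernel)
  let ?B = "{w :: expo4. \<forall>i. Poly_Mapping.lookup w i < n 1 + 1}"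
  have "finite (Poly_Mapping.lookup ` ?B)"
  proof (rule finite_subset)
    show "Poly_Mapping.lookup ` ?B \<subseteq> PiE UNIV (\<lambda>_. {..< n 1 + 1})" by auto
    show "finite (PiE (UNIV :: 4 set) (\<lambda>_. {..< n 1 + 1}))" by (intro finite_PiE) auto
  qed
  then have "finite ?B"
    by (rule finite_imageD) (simp add: inj_on_def lookup_inject)
  then have fin: "finite (xmonomial ` ?B :: 'k poly4 set)" by simp
  show ?thesis
  proof (rule noetherian_quotient[OF fin])
    fix M :: "'k poly4 set"
    assume J: "top_kernel n \<subseteq> M" and E: "xmonomial ` ?B \<subseteq> M"
      and add: "\<And>a b. a \<in> M \<Longrightarrow> b \<in> M \<Longrightarrow> a + b \<in> M"
      and mult: "\<And>p a. a \<in> M \<Longrightarrow> axis_poly p * a \<in> M"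
    have "f \<in> M" for f
    proof (induction f rule: poly4_induct)
      case (single u c)
      define w where "w = u - Poly_Mapping.single 1 (Poly_Mapping.lookup u 1)"
      have u: "u = Poly_Mapping.single 1 (Poly_Mapping.lookup u 1) + w"
        unfolding w_def by (rule expo_split) simp
      have w1: "Poly_Mapping.lookup w 1 = 0" by (simp add: w_def lookup_minus)
      have "xmonomial w \<in> M"
      proof (cases "w \<in> ?B")
        case True
        then show ?thesis using E by blast
      next
        case False
        then obtain i where "n 1 + 1 \<le> Poly_Mapping.lookup w i" by (auto simp: not_less)
        then have i: "n 1 \<le> Poly_Mapping.lookup w i" "i \<noteq> 1" using w1 by auto
        have "xvar i ^ n 1 * xmonomial (w - Poly_Mapping.single i (n 1)) \<in> (top_kernel n :: 'k poly4 set)"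
          by (rule ideal_type_ringD(4)[OF ideal_top_kernel xvar_power_in_top_kernel[OF i(2)]])
        moreover have "xvar i ^ n 1 * xmonomial (w - Poly_Mapping.single i (n 1)) = (xmonomial w :: 'k poly4)"
          by (simp add: xvar_power xmonomial_def mult_single flip: expo_split[OF i(1)])
        ultimately show ?thesis using J by (metis subsetD)
      qed
      then have "axis_poly (Polynomial.monom c (Poly_Mapping.lookup u 1)) * xmonomial w \<in> M" by (rule mult)
      moreover have "axis_poly (Polynomial.monom c (Poly_Mapping.lookup u 1)) * xmonomial w = Poly_Mapping.single u c"
        by (simp add: axis_poly_monom xmonomial_def mult_single flip: u)
      ultimately show ?case by simp
    qed (rule add)
    then show "M = UNIV" by auto
  qed
qed

text \<open>Factors \<open>x\<^sub>1\<close> of \<open>p\<close> are cancelled first. If then \<open>p\<close> has constant term \<open>a \<noteq> 0\<close>, the functional of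
weight \<open>s\<close> takes on \<open>p r\<close> the value \<open>a\<close> times its value on \<open>r\<close>, provided that those of smaller weight
vanish on \<open>r\<close>.\<close>

lemma axis_poly_nonzerodivisor:
  fixes r :: "'k::field poly4"
  assumes nzd: "\<And>r :: 'k poly4. xvar 1 * r \<in> top_kernel n \<Longrightarrow> r \<in> top_kernel n"
    and "p \<noteq> 0" "axis_poly p * r \<in> top_kernel n"
  shows "r \<in> top_kernel n"
  using assms(2,3)
proof (induction p)
  case (pCons a p)
  show ?case
  proof (cases "a = 0")
    case True
    then have "p \<noteq> 0" "xvar 1 * (axis_poly p * r) \<in> top_kernel n"
      using pCons.prems by (auto simp: axis_poly_pCons mult.assoc)
    then show ?thesis by (rule pCons.IH[OF _ nzd])
  next
    case False
    have "top_sum n s r = 0" for s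
    proof (induction s rule: less_induct)
      case (less s)
      have "top_sum n s (xvar 1 * (axis_poly p * r)) = 0"
      proof -
        have "top_sum n t r = 0" if "t \<le> s - n 1" "n 1 \<le> s" for t
          using less.IH[of t] that pos[of 1] by linarith
        then show ?thesis unfolding xvar_def xmonomial_def top_sum_single_mult
          by (auto intro: top_sum_mult_eq_0)
      qed
      moreover have "top_sum n s (axis_poly (pCons a p) * r) = 0"
        using pCons.prems(2) by (simp add: top_kernel_def)
      then have "top_sum n s (Poly_Mapping.single 0 a * r) + top_sum n s (xvar 1 * (axis_poly p * r)) = 0"
        by (simp add: axis_poly_pCons distrib_right top_sum_add mult.assoc)
      moreover have "top_sum n s (Poly_Mapping.single 0 a * r) = a * top_sum n s r"
        by (simp add: top_sum_def coeff_sum_single_mult)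
      ultimately show ?case using False by simp
    qed
    then show ?thesis by (simp add: top_kernel_def)
  qed
qed simp

text \<open>Let \<open>u\<close> be of top degree. If \<open>x\<^sub>1 x\<^sup>u\<close> is not, then \<open>x\<^sup>u\<close> is a nonzero element of the tangent cone that
\<open>x\<^sub>1\<close> kills. Otherwise \<open>x\<^sub>1\<close> shifts the functional of weight \<open>s\<close> to that of weight \<open>n\<^sub>1 + s\<close>.\<close>

lemma xvar_nonzerodivisor_iff:
  "(\<forall>r :: 'k::field poly4. xvar 1 * r \<in> top_kernel n \<longrightarrow> r \<in> top_kernel n) \<longleftrightarrow>
    (\<forall>u. top_degree n u \<longrightarrow> top_degree n (Poly_Mapping.single 1 1 + u))"
proof
  assume nzd: "\<forall>r :: 'k poly4. xvar 1 * r \<in> top_kernel n \<longrightarrow> r \<in> top_kernel n"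
  show "\<forall>u. top_degree n u \<longrightarrow> top_degree n (Poly_Mapping.single 1 1 + u)"
  proof (intro allI impI, rule ccontr)
    fix u assume u: "top_degree n u" and nt: "\<not> top_degree n (Poly_Mapping.single 1 1 + u)"
    have "xvar 1 * Poly_Mapping.single u 1 \<in> (top_kernel n :: 'k poly4 set)"
      using nt by (simp add: xvar_def xmonomial_def mult_single single_in_top_kernel)
    then have "Poly_Mapping.single u 1 \<in> (top_kernel n :: 'k poly4 set)" using nzd by blast
    with u show False by (simp add: single_in_top_kernel)
  qed
next
  assume top: "\<forall>u. top_degree n u \<longrightarrow> top_degree n (Poly_Mapping.single 1 1 + u)"
  show "\<forall>r :: 'k poly4. xvar 1 * r \<in> top_kernel n \<longrightarrow> r \<in> top_kernel n"
  proof (intro allI impI)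
    fix r :: "'k poly4" assume r: "xvar 1 * r \<in> top_kernel n"
    have "top_sum n s r = 0" for s
    proof (cases "\<exists>u. weight n u = s \<and> top_degree n u")
      case True
      then have ex: "\<exists>u. weight n (Poly_Mapping.single 1 1 + u) = n 1 + s \<and> top_degree n (Poly_Mapping.single 1 1 + u)"
        using top by auto
      have "top_sum n (n 1 + s) (xvar 1 * r) = 0" using r by (simp add: top_kernel_def)
      then show ?thesis unfolding xvar_def xmonomial_def top_sum_single_mult if_P[OF ex] by simp
    next
      case False
      then show ?thesis unfolding top_sum_def coeff_sum_def by (intro sum.neutral) auto
    qed
    then show "r \<in> top_kernel n" by (simp add: top_kernel_def)
  qed
qed

lemma cohen_macaulay_tangent_cone_iff:
  "cohen_macaulay_tangent_cone TYPE('k::field) n \<longleftrightarrow>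
    (\<forall>u. top_degree n u \<longrightarrow> top_degree n (Poly_Mapping.single 1 1 + u))"
proof -
  interpret thickened_line "top_kernel n" "axis_poly :: 'k poly \<Rightarrow> 'k poly4"
    by (rule thickened_line_top_kernel)
  have "cohen_macaulay_ring ((type_ring :: 'k poly4 ring) Quot top_kernel n) \<longleftrightarrow>
      (\<forall>r :: 'k poly4. axis_poly [:0, 1:] * r \<in> top_kernel n \<longrightarrow> r \<in> top_kernel n)"
    by (rule cohen_macaulay_iff[OF noetherian_tangent_cone])
      (use axis_poly_nonzerodivisor in \<open>unfold axis_poly_X, blast\<close>)
  then show ?thesis
    unfolding cohen_macaulay_tangent_cone_def tangent_ideal_curve_ideal axis_poly_X xvar_nonzerodivisor_iff .
qed

end

section \<open>Fibres and moves\<close>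

text \<open>If the set of exponents described by \<open>Q\<close> is a union of components of the graph of moves, then the
functional of \<open>Q\<close> kills every multiple of a generator by a monomial.\<close>

lemma coeff_sum_binomial_ideal:
  fixes G :: "'k::field poly4 set"
  assumes gen: "\<And>g. g \<in> G \<Longrightarrow> \<exists>a b. g = xmonomial a - xmonomial b \<and> (\<forall>w. Q (w + a) = Q (w + b))"
    and f: "f \<in> Idl\<^bsub>type_ring\<^esub> G"
  shows "coeff_sum Q f = 0"
proof -
  interpret R: cring "type_ring :: 'k poly4 ring" by (rule cring_type_ring)
  define I where "I = {f :: 'k poly4. \<forall>w. coeff_sum (\<lambda>u. Q (w + u)) f = 0}"
  have "ideal I type_ring"
    unfolding ideal_type_ring_iff
  proof (intro conjI ballI allI)
    fix r g :: "'k poly4" assume g: "g \<in> I"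
    show "r * g \<in> I"
    proof (induction r rule: poly4_induct)
      case (single v c)
      have "coeff_sum (\<lambda>u. Q (w + (v + u))) g = 0" for w
        using g unfolding I_def add.assoc[symmetric] by blast
      then show ?case unfolding I_def by (simp add: coeff_sum_single_mult)
    qed (simp add: I_def distrib_right coeff_sum_add)
  qed (simp_all add: I_def coeff_sum_add)
  moreover have "G \<subseteq> I"
  proof
    fix g assume "g \<in> G"
    then obtain a b where g: "g = xmonomial a - xmonomial b" and ab: "\<forall>w. Q (w + a) = Q (w + b)"
      using gen by blast
    show "g \<in> I" unfolding I_def g using ab by (simp add: coeff_sum_diff xmonomial_def coeff_sum_single)
  qed
  ultimately have "f \<in> I" using R.genideal_minimal f by blast
  then have "coeff_sum (\<lambda>u. Q (0 + u)) f = 0" unfolding I_def by blast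
  then show ?thesis by simp
qed

text \<open>A predicate that is invariant under the moves given by binomial generators is constant on the fibres.
In the application \<open>Q\<close> describes a set of one or two monomials.\<close>

lemma fibre_connected:
  fixes G :: "'k::field poly4 set" and Q :: "expo4 \<Rightarrow> bool"
  assumes G: "Idl\<^bsub>type_ring\<^esub> G = curve_ideal n"
    and gen: "\<And>g. g \<in> G \<Longrightarrow> \<exists>a b. g = xmonomial a - xmonomial b \<and> (\<forall>w. Q (w + a) = Q (w + b))"
    and uv: "weight n u = weight n v"
  shows "Q u = Q v"
proof -
  have "xmonomial u - xmonomial v \<in> Idl\<^bsub>type_ring\<^esub> G"
    unfolding G using uv by (simp add: binomial_in_curve_ideal)
  then have "coeff_sum Q (xmonomial u - xmonomial v :: 'k poly4) = 0"
    using coeff_sum_binomial_ideal[of G Q] gen by blast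
  then show ?thesis by (auto simp: coeff_sum_diff xmonomial_def coeff_sum_single split: if_splits)
qed

definition expo :: "nat \<Rightarrow> nat \<Rightarrow> nat \<Rightarrow> nat \<Rightarrow> expo4" where
  "expo a b c d = Poly_Mapping.single 1 a + Poly_Mapping.single 2 b
    + Poly_Mapping.single 3 c + Poly_Mapping.single 4 d"

lemma lookup_expo [simp]:
  "Poly_Mapping.lookup (expo a b c d) 1 = a" "Poly_Mapping.lookup (expo a b c d) 2 = b"
  "Poly_Mapping.lookup (expo a b c d) 3 = c" "Poly_Mapping.lookup (expo a b c d) 4 = d"
  unfolding expo_def lookup_add lookup_single by (simp_all only: four_distinct when_simps) simp_all

lemma expo_eqI:
  assumes "Poly_Mapping.lookup u 1 = Poly_Mapping.lookup v 1" "Poly_Mapping.lookup u 2 = Poly_Mapping.lookup v 2"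
    "Poly_Mapping.lookup u 3 = Poly_Mapping.lookup v 3" "Poly_Mapping.lookup u 4 = Poly_Mapping.lookup v (4 :: 4)"
  shows "u = v"
proof (rule poly_mapping_eqI)
  fix i show "Poly_Mapping.lookup u i = Poly_Mapping.lookup v i"
    using four_cases[of i] assms by (elim disjE) simp_all
qed

lemma expo_cases: obtains a b c d where "u = expo a b c d"
proof
  show "u = expo (Poly_Mapping.lookup u 1) (Poly_Mapping.lookup u 2) (Poly_Mapping.lookup u 3) (Poly_Mapping.lookup u 4)"
    by (rule expo_eqI) simp_all
qed

lemma expo_add: "expo a b c d + expo a' b' c' d' = expo (a + a') (b + b') (c + c') (d + d')"
  by (simp add: expo_def single_add algebra_simps)

lemma expo_inject: "expo a b c d = expo a' b' c' d' \<longleftrightarrow> a = a' \<and> b = b' \<and> c = c' \<and> d = d'"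
  by (metis lookup_expo)

lemma weight_expo: "weight n (expo a b c d) = a * n 1 + b * n 2 + c * n 3 + d * n 4"
  by (simp add: expo_def)

lemma expo_deg_expo: "expo_deg (expo a b c d) = a + b + c + d"
  by (simp add: expo_def)

lemma xmonomial_expo:
  "xmonomial (expo a b c d) = xvar 1 ^ a * xvar 2 ^ b * xvar 3 ^ c * (xvar 4 ^ d :: 'k::field poly4)"
  by (simp add: expo_def xvar_power mult_single xmonomial_def)

lemma shifted_semigroup_iff:
  "s \<in> (\<lambda>m. n 1 + m) ` curve_semigroup n \<longleftrightarrow> (\<exists>v. weight n v = s \<and> 0 < Poly_Mapping.lookup v 1)"
proof
  assume "s \<in> (\<lambda>m. n 1 + m) ` curve_semigroup n"
  then obtain g where g: "s = n 1 + (\<Sum>i\<in>UNIV. g i * n i)" unfolding curve_semigroup_def by blast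
  have "weight n (Abs_poly_mapping g) = (\<Sum>i\<in>UNIV. g i * n i)" by (simp add: weight_def)
  then have "weight n (Poly_Mapping.single 1 1 + Abs_poly_mapping g) = s" using g by simp
  moreover have "0 < Poly_Mapping.lookup (Poly_Mapping.single 1 1 + Abs_poly_mapping g) 1"
    by (simp add: lookup_add)
  ultimately show "\<exists>v. weight n v = s \<and> 0 < Poly_Mapping.lookup v 1" by blast
next
  assume "\<exists>v. weight n v = s \<and> 0 < Poly_Mapping.lookup v 1"
  then obtain v where v: "weight n v = s" "1 \<le> Poly_Mapping.lookup v 1" by (auto simp: Suc_le_eq)
  then have "s = n 1 + weight n (v - Poly_Mapping.single 1 1)"
    using arg_cong[OF expo_split[OF v(2)], of "weight n"] by simp
  moreover have "weight n (v - Poly_Mapping.single 1 1) \<in> curve_semigroup n"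
    unfolding curve_semigroup_def weight_def by blast
  ultimately show "s \<in> (\<lambda>m. n 1 + m) ` curve_semigroup n" by blast
qed

context monomial_curve
begin

text \<open>The multiples of \<open>x\<^sub>1\<close> in the fibre of \<open>M\<close> are obtained from a single fibre by multiplication with
\<open>x\<^sub>1\<close>. The left-hand side says that a monomial of top degree there remains of top degree in the fibre
of \<open>M\<close>.\<close>

lemma top_degree_shift_iff:
  "(\<forall>u. top_degree n u \<longrightarrow> top_degree n (Poly_Mapping.single 1 1 + u)) \<longleftrightarrow>
    (\<forall>M N. weight n N = weight n M \<and> 0 < Poly_Mapping.lookup N 1 \<longrightarrow>
      (\<exists>N'. weight n N' = weight n M \<and> 0 < Poly_Mapping.lookup N' 1 \<and> expo_deg M \<le> expo_deg N'))"
proof (intro iffI allI impI)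
  fix M N assume top: "\<forall>u. top_degree n u \<longrightarrow> top_degree n (Poly_Mapping.single 1 1 + u)"
    and "weight n N = weight n M \<and> 0 < Poly_Mapping.lookup N 1"
  then have N: "weight n N = weight n M" "1 \<le> Poly_Mapping.lookup N 1" by (auto simp: Suc_le_eq)
  obtain v where v: "weight n v = weight n (N - Poly_Mapping.single 1 1)" "top_degree n v"
    using ex_top_degree by blast
  have w: "weight n (Poly_Mapping.single 1 1 + v) = weight n M"
    using arg_cong[OF expo_split[OF N(2)], of "weight n"] N(1) v(1) by simp
  moreover have "expo_deg M \<le> expo_deg (Poly_Mapping.single 1 1 + v)"
    using top v(2) w unfolding top_degree_def by metis
  moreover have "0 < Poly_Mapping.lookup (Poly_Mapping.single 1 1 + v) 1" by (simp add: lookup_add)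
  ultimately show "\<exists>N'. weight n N' = weight n M \<and> 0 < Poly_Mapping.lookup N' 1 \<and> expo_deg M \<le> expo_deg N'"
    by blast
next
  fix u assume ex: "\<forall>M N. weight n N = weight n M \<and> 0 < Poly_Mapping.lookup N 1 \<longrightarrow>
      (\<exists>N'. weight n N' = weight n M \<and> 0 < Poly_Mapping.lookup N' 1 \<and> expo_deg M \<le> expo_deg N')"
    and u: "top_degree n u"
  show "top_degree n (Poly_Mapping.single 1 1 + u)"
    unfolding top_degree_def
  proof (intro allI impI)
    fix M assume M: "weight n M = weight n (Poly_Mapping.single 1 1 + u)"
    have "0 < Poly_Mapping.lookup (Poly_Mapping.single 1 1 + u) 1" by (simp add: lookup_add)
    with ex M obtain N where N: "weight n N = weight n M" "0 < Poly_Mapping.lookup N 1" "expo_deg M \<le> expo_deg N"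
      by metis
    then have N1: "1 \<le> Poly_Mapping.lookup N 1" by simp
    let ?N = "N - Poly_Mapping.single 1 1"
    have "weight n N = n 1 + weight n ?N" "expo_deg N = 1 + expo_deg ?N"
      using arg_cong[OF expo_split[OF N1], of "weight n"] arg_cong[OF expo_split[OF N1], of expo_deg] by simp_all
    moreover from this have "weight n ?N = weight n u" using M N(1) by simp
    then have "expo_deg ?N \<le> expo_deg u" using u unfolding top_degree_def by blast
    ultimately show "expo_deg M \<le> expo_deg (Poly_Mapping.single 1 1 + u)" using N(3) by simp
  qed
qed

end

section \<open>The curve defined by five binomials\<close>

theorem proposition3p31:
  fixes n :: "4 \<Rightarrow> nat"
    and a1 a2 a3 a4 a12 a14 a23 a24 a31 a32 a41 a43 :: nat
    and x :: "4 \<Rightarrow> 'k::field poly4"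
  defines "x \<equiv> xvar"
  assumes "\<And>i. 0 < n i" and "Gcd (range n) = 1"
    and "n 1 < n 2" and "n 2 < n 3" and "n 3 < n 4"
    and "gorenstein_curve n" and "\<not> complete_intersection_curve TYPE('k) n"
    and "0 < a12" "a12 < a2" and "0 < a14" "a14 < a4"
    and "0 < a23" "a23 < a3" and "0 < a24" "a24 < a4"
    and "0 < a31" "a31 < a1" and "0 < a32" "a32 < a2"
    and "0 < a41" "a41 < a1" and "0 < a43" "a43 < a3"
    and "a1 = a31 + a41" and "a2 = a12 + a32" and "a3 = a23 + a43" and "a4 = a14 + a24"
    and "minimally_generates
           {x 1 ^ a1 - x 2 ^ a12 * x 4 ^ a14,
            x 2 ^ a2 - x 3 ^ a23 * x 4 ^ a24,
            x 3 ^ a3 - x 1 ^ a31 * x 2 ^ a32,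
            x 4 ^ a4 - x 1 ^ a41 * x 3 ^ a43,
            x 1 ^ a31 * x 4 ^ a24 - x 2 ^ a12 * x 3 ^ a43}
           (curve_ideal n)"
  shows "cohen_macaulay_tangent_cone TYPE('k) n \<longleftrightarrow>
     a12 + a43 \<le> a31 + a24 \<and>
     (\<forall>u2 u3 u4 :: nat.
        a2 \<le> u2 \<and> u3 < a43 \<and> u4 < a14 \<and>
        u2 * n 2 + u3 * n 3 + u4 * n 4 \<in> (\<lambda>m. n 1 + m) ` curve_semigroup n \<longrightarrow>
        (\<exists>v :: expo4. 1 \<in> Poly_Mapping.keys v \<and>
           x 2 ^ u2 * x 3 ^ u3 * x 4 ^ u4 - xmonomial v \<in> curve_ideal n \<and>
           u2 + u3 + u4 \<le> expo_deg v))"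
proof -
  interpret monomial_curve n
  proof
    fix i :: 4
    show "0 < n i" by fact
    assume "i \<noteq> 1"
    then show "n 1 < n i" using four_cases[of i] assms(4-6) by auto
  qed
  let ?moves = "{(expo a1 0 0 0, expo 0 a12 0 a14), (expo 0 a2 0 0, expo 0 0 a23 a24),
    (expo 0 0 a3 0, expo a31 a32 0 0), (expo 0 0 0 a4, expo a41 0 a43 0),
    (expo a31 0 0 a24, expo 0 a12 a43 0)}"
  define G :: "'k poly4 set" where "G = (\<lambda>(a, b). xmonomial a - xmonomial b) ` ?moves"
  have "{x 1 ^ a1 - x 2 ^ a12 * x 4 ^ a14, x 2 ^ a2 - x 3 ^ a23 * x 4 ^ a24,
      x 3 ^ a3 - x 1 ^ a31 * x 2 ^ a32, x 4 ^ a4 - x 1 ^ a41 * x 3 ^ a43,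
      x 1 ^ a31 * x 4 ^ a24 - x 2 ^ a12 * x 3 ^ a43} = G"
    unfolding G_def x_def by (simp add: xmonomial_expo)
  then have G: "Idl\<^bsub>type_ring\<^esub> G = curve_ideal n"
    using assms(29) unfolding minimally_generates_def by simp
  have move_weight: "weight n a = weight n b" if "(a, b) \<in> ?moves" for a b
  proof -
    interpret R: cring "type_ring :: 'k poly4 ring" by (rule cring_type_ring)
    have "xmonomial a - xmonomial b \<in> G" using that unfolding G_def by (rule rev_image_eqI) simp
    then have "xmonomial a - xmonomial b \<in> (curve_ideal n :: 'k poly4 set)"
      using R.genideal_self[of G] G by auto
    then show ?thesis by (simp add: binomial_in_curve_ideal)
  qed
  have e1: "a1 * n 1 = a12 * n 2 + a14 * n 4" using move_weight[of "expo a1 0 0 0" "expo 0 a12 0 a14"] by (simp add: weight_expo)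
  have e2: "a2 * n 2 = a23 * n 3 + a24 * n 4" using move_weight[of "expo 0 a2 0 0" "expo 0 0 a23 a24"] by (simp add: weight_expo)
  have e3: "a3 * n 3 = a31 * n 1 + a32 * n 2" using move_weight[of "expo 0 0 a3 0" "expo a31 a32 0 0"] by (simp add: weight_expo)
  have e4: "a4 * n 4 = a41 * n 1 + a43 * n 3" using move_weight[of "expo 0 0 0 a4" "expo a41 0 a43 0"] by (simp add: weight_expo)
  have e5: "a31 * n 1 + a24 * n 4 = a12 * n 2 + a43 * n 3"
    using move_weight[of "expo a31 0 0 a24" "expo 0 a12 a43 0"] by (simp add: weight_expo)
  have connected: "Q u = Q v"
    if moves: "\<And>a b w. (a, b) \<in> ?moves \<Longrightarrow> Q (w + a) = Q (w + b)" and uv: "weight n u = weight n v"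
    for Q :: "expo4 \<Rightarrow> bool" and u v
  proof (rule fibre_connected[OF G _ uv])
    fix g assume "g \<in> G"
    then obtain a b where "(a, b) \<in> ?moves" "g = xmonomial a - xmonomial b" unfolding G_def by fast
    then show "\<exists>a b. g = xmonomial a - xmonomial b \<and> (\<forall>w. Q (w + a) = Q (w + b))"
      using moves by metis
  qed
  \<comment> \<open>The two terms of a generator have equal weight, so the one in variables of larger weight has the
    smaller degree. This orders the terms of the first four generators.\<close>
  have d1: "a12 + a14 < a1"
  proof -
    have "a12 * n 1 < a12 * n 2" "a14 * n 1 < a14 * n 4" using assms by auto
    then have "(a12 + a14) * n 1 < a1 * n 1" unfolding distrib_right e1 by (rule add_strict_mono)
    then show ?thesis by simp
  qed
  have d2: "a23 + a24 < a2"
  proof -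
    have "a23 * n 2 < a23 * n 3" "a24 * n 2 < a24 * n 4" using assms by auto
    then have "(a23 + a24) * n 2 < a2 * n 2" unfolding distrib_right e2 by (rule add_strict_mono)
    then show ?thesis by simp
  qed
  have d3: "a3 < a31 + a32"
  proof -
    have "a31 * n 1 < a31 * n 3" "a32 * n 2 < a32 * n 3" using assms by auto
    then have "a3 * n 3 < (a31 + a32) * n 3" unfolding distrib_right e3 by (rule add_strict_mono)
    then show ?thesis by simp
  qed
  have d4: "a4 < a41 + a43"
  proof -
    have "a41 * n 1 < a41 * n 4" "a43 * n 3 < a43 * n 4" using assms by auto
    then have "a4 * n 4 < (a41 + a43) * n 4" unfolding distrib_right e4 by (rule add_strict_mono)
    then show ?thesis by simp
  qed
  let ?lifts = "\<lambda>M. \<exists>N. weight n N = weight n M \<and> 0 < Poly_Mapping.lookup N 1 \<and> expo_deg M \<le> expo_deg N"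
  let ?meets = "\<lambda>M. \<exists>N. weight n N = weight n M \<and> 0 < Poly_Mapping.lookup N 1"
  have two: "(u2 * n 2 + u3 * n 3 + u4 * n 4 \<in> (\<lambda>m. n 1 + m) ` curve_semigroup n) = ?meets (expo 0 u2 u3 u4)"
    "(\<exists>v :: expo4. 1 \<in> Poly_Mapping.keys v \<and> x 2 ^ u2 * x 3 ^ u3 * x 4 ^ u4 - xmonomial v \<in> curve_ideal n \<and>
       u2 + u3 + u4 \<le> expo_deg v) = ?lifts (expo 0 u2 u3 u4)" for u2 u3 u4
  proof -
    show "(u2 * n 2 + u3 * n 3 + u4 * n 4 \<in> (\<lambda>m. n 1 + m) ` curve_semigroup n) = ?meets (expo 0 u2 u3 u4)"
      unfolding shifted_semigroup_iff by (simp add: weight_expo)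
    have "x 2 ^ u2 * x 3 ^ u3 * x 4 ^ u4 = xmonomial (expo 0 u2 u3 u4)" by (simp add: x_def xmonomial_expo)
    then show "(\<exists>v :: expo4. 1 \<in> Poly_Mapping.keys v \<and> x 2 ^ u2 * x 3 ^ u3 * x 4 ^ u4 - xmonomial v \<in> curve_ideal n \<and>
       u2 + u3 + u4 \<le> expo_deg v) = ?lifts (expo 0 u2 u3 u4)"
      by (simp add: binomial_in_curve_ideal in_keys_iff expo_deg_expo eq_commute[of "weight n (expo 0 u2 u3 u4)"])
        (meson)
  qed
  show ?thesis
    unfolding cohen_macaulay_tangent_cone_iff top_degree_shift_iff two
  proof (intro iffI conjI allI impI)
    assume all: "\<forall>M N. weight n N = weight n M \<and> 0 < Poly_Mapping.lookup N 1 \<longrightarrow> ?lifts M"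
    then show "?lifts (expo 0 u2 u3 u4)"
      if "a2 \<le> u2 \<and> u3 < a43 \<and> u4 < a14 \<and> ?meets (expo 0 u2 u3 u4)" for u2 u3 u4
      using that by metis
    let ?M = "expo 0 a12 a43 0" and ?N = "expo a31 0 0 a24"
    have "weight n ?N = weight n ?M \<and> 0 < Poly_Mapping.lookup ?N 1" using e5 \<open>0 < a31\<close> by (simp add: weight_expo)
    with all obtain N where N: "weight n N = weight n ?M" "0 < Poly_Mapping.lookup N 1" "expo_deg ?M \<le> expo_deg N"
      by blast
    \<comment> \<open>No move other than the fifth applies to one of these two monomials.\<close>
    have "(N = ?M \<or> N = ?N) = (?M = ?M \<or> ?M = ?N)"
    proof (rule connected[OF _ N(1), of "\<lambda>u. u = ?M \<or> u = ?N"])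
      fix a b w assume "(a, b) \<in> ?moves"
      then show "(w + a = ?M \<or> w + a = ?N) = (w + b = ?M \<or> w + b = ?N)"
        by (cases w rule: expo_cases) (use assms(9-24) in \<open>auto simp: expo_add expo_inject\<close>)
    qed
    with N(2) have "N = ?N" by auto
    with N(3) show "a12 + a43 \<le> a31 + a24" by (simp add: expo_deg_expo)
  next
    fix M N
    assume "a12 + a43 \<le> a31 + a24 \<and> (\<forall>u2 u3 u4. a2 \<le> u2 \<and> u3 < a43 \<and> u4 < a14 \<and> ?meets (expo 0 u2 u3 u4) \<longrightarrow> ?lifts (expo 0 u2 u3 u4))"
      and N: "weight n N = weight n M \<and> 0 < Poly_Mapping.lookup N 1"
    then have c1: "a12 + a43 \<le> a31 + a24"
      and c2: "\<And>u2 u3 u4. a2 \<le> u2 \<Longrightarrow> u3 < a43 \<Longrightarrow> u4 < a14 \<Longrightarrow> ?meets (expo 0 u2 u3 u4) \<Longrightarrow> ?lifts (expo 0 u2 u3 u4)"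
      by blast+
    obtain M' where M': "weight n M' = weight n M" "top_degree n M'" "expo_deg M \<le> expo_deg M'"
      using ex_top_degree by blast
    obtain m1 m2 m3 m4 where m: "M' = expo m1 m2 m3 m4" by (rule expo_cases)
    \<comment> \<open>It suffices to treat a monomial of top degree in the fibre, since its degree bounds that of \<open>M\<close>.\<close>
    have "?lifts M'"
    proof (rule ccontr)
      assume no: "\<not> ?lifts M'"
      have m1: "m1 = 0" using no m by force
      have no': False if "v1 * n 1 + v2 * n 2 + v3 * n 3 + v4 * n 4 = m2 * n 2 + m3 * n 3 + m4 * n 4"
        "0 < v1" "m2 + m3 + m4 \<le> v1 + v2 + v3 + v4" for v1 v2 v3 v4
        using no that by (auto simp: m m1 weight_expo expo_deg_expo dest!: spec[of _ "expo v1 v2 v3 v4"])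
      have n14: "\<not> (a12 \<le> m2 \<and> a14 \<le> m4)"
      proof
        assume le: "a12 \<le> m2 \<and> a14 \<le> m4"
        then obtain k l where k: "m2 = a12 + k" "m4 = a14 + l" by (auto simp: le_iff_add)
        show False by (rule no'[of a1 k m3 l]) (use e1 d1 k in \<open>auto simp: algebra_simps\<close>)
      qed
      have n4: "m4 < a4"
      proof (rule ccontr)
        assume "\<not> m4 < a4"
        then obtain k where k: "m4 = a4 + k" by (auto simp: not_less le_iff_add)
        show False by (rule no'[of a41 m2 "m3 + a43" k]) (use e4 d4 k \<open>0 < a41\<close> in \<open>auto simp: algebra_simps\<close>)
      qed
      have n3: "m3 < a3"
      proof (rule ccontr)
        assume "\<not> m3 < a3"
        then obtain k where k: "m3 = a3 + k" by (auto simp: not_less le_iff_add)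
        show False by (rule no'[of a31 "m2 + a32" k m4]) (use e3 d3 k \<open>0 < a31\<close> in \<open>auto simp: algebra_simps\<close>)
      qed
      have n23: "\<not> (a12 \<le> m2 \<and> a43 \<le> m3)"
      proof
        assume le: "a12 \<le> m2 \<and> a43 \<le> m3"
        then obtain k l where k: "m2 = a12 + k" "m3 = a43 + l" by (auto simp: le_iff_add)
        show False by (rule no'[of a31 k l "m4 + a24"]) (use e5 c1 k \<open>0 < a31\<close> in \<open>auto simp: algebra_simps\<close>)
      qed
      have n34: "\<not> (a23 \<le> m3 \<and> a24 \<le> m4)"
      proof
        assume le: "a23 \<le> m3 \<and> a24 \<le> m4"
        then obtain k l where k: "m3 = a23 + k" "m4 = a24 + l" by (auto simp: le_iff_add)
        have "weight n (expo 0 (m2 + a2) k l) = weight n M'"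
          using e2 by (simp add: m m1 k weight_expo algebra_simps)
        then have "expo_deg (expo 0 (m2 + a2) k l) \<le> expo_deg M'" using M'(2) unfolding top_degree_def by blast
        with d2 show False by (simp add: m m1 k expo_deg_expo)
      qed
      have "a2 \<le> m2"
      proof (rule ccontr)
        assume n2: "\<not> a2 \<le> m2"
        \<comment> \<open>Otherwise no move applies to \<open>M'\<close>, so its fibre is a single monomial, but \<open>N\<close> is a multiple of \<open>x\<^sub>1\<close>
          and \<open>M'\<close> is not.\<close>
        have "(N = M') = (M' = M')"
        proof (rule connected[of "\<lambda>u. u = M'"])
          fix a b w assume "(a, b) \<in> ?moves"
          then show "(w + a = M') = (w + b = M')"
            by (cases w rule: expo_cases)
              (use n14 n4 n3 n23 n34 n2 assms(9-24) in \<open>auto simp: expo_add expo_inject m m1\<close>)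
        qed (use N M'(1) in simp)
        with N m m1 show False by simp
      qed
      moreover have "m3 < a43" "m4 < a14" using n23 n14 \<open>a2 \<le> m2\<close> \<open>a12 < a2\<close> by auto
      ultimately have "?lifts (expo 0 m2 m3 m4)" using N M'(1) m m1 by (intro c2) auto
      with no show False using m m1 by simp
    qed
    then show "?lifts M" using M' by (metis le_trans)
  qed
qed

end
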